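(* Suppose that a point $P=(a,b)\in\mathcal{C}(K_0)\subset J(K_0)$, i.e., $a,b\in K_0$ and $b^2=f(a)$. If $\mathfrak{r}$ is an element of $\mathfrak{R}_{1/2,P}$, then $\mathfrak{a}_{\mathfrak{r}}$ lies in $J(K_0)$ if and only if $h_{\mathfrak{r}}(t)$ lies in $K_0[t]$, i.e., $\mathbf{s}_i(\mathfrak{r})\in K_0$ for all $i=1,\dots,2g$.
   Context: $K$ is an algebraically closed field of characteristic different from $2$, $g\ge 1$ is an integer, $\alpha_1,\dots,\alpha_{2g+1}$ are distinct elements of $K$, and $f(x)=\prod_{i=1}^{2g+1}(x-\alpha_i)$. $K_0$ is a subfield of $K$ such that $f(x)\in K_0[x]$ (the roots $\alpha_i$ need not lie in $K_0$). $\mathcal{C}$ is the smooth projective model of $y^2=f(x)$, a genus $g$ hyperelliptic curve with exactly one infinite point $\infty$; $\mathfrak{W}_i=(\alpha_i,0)$; $\iota:(x,y)\mapsto(x,-y)$, $\infty\mapsto\infty$. $J$ is the jacobian of $\mathcal{C}$; both $\mathcal{C}$ and $J$ are defined over $K_0$, and $\infty\in\mathcal{C}(K_0)$. $\mathcal{C}$ is identified with its image in $J$ under the embedding $P\mapsto\mathrm{cl}((P)-(\infty))$ (defined over $K_0$), where $\mathrm{cl}$ denotes linear equivalence class. For $P=(a,b)\in\mathcal{C}(K)$, $\mathfrak{R}_{1/2,P}$ is the set of all $\mathfrak{r}=(\mathfrak{r}_1,\dots,\mathfrak{r}_{2g+1})\in K^{2g+1}$ with $\mathfrak{r}_i^2=a-\alpha_i$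 for all $i$ and $\prod_{i=1}^{2g+1}\mathfrak{r}_i=-b$; $\mathbf{s}_i(\mathfrak{r})$ is the $i$th elementary symmetric function of $\mathfrak{r}_1,\dots,\mathfrak{r}_{2g+1}$, and $h_{\mathfrak{r}}(t)=\prod_{i=1}^{2g+1}(t-\mathfrak{r}_i)$ (so $\mathbf{s}_{2g+1}(\mathfrak{r})=-b$). Put $$U_{\mathfrak{r}}(x)=(-1)^g\Big[(a-x)^g+\sum_{j=1}^g\mathbf{s}_{2j}(\mathfrak{r})(a-x)^{g-j}\Big],$$ $$V_{\mathfrak{r}}(x)=\Big[\sum_{j=1}^g\mathbf{s}_{2j-1}(\mathfrak{r})(a-x)^{g-j+1}\Big]-b-\mathbf{s}_1(\mathfrak{r})\Big[(a-x)^g+\sum_{j=1}^g\mathbf{s}_{2j}(\mathfrak{r})(a-x)^{g-j}\Big].$$ Then $\mathfrak{a}_{\mathfrak{r}}\in J(K)$ denotes the point with Mumford's representation $(U_{\mathfrak{r}},V_{\mathfrak{r}})$: $\mathfrak{a}_{\mathfrak{r}}=\mathrm{cl}(D-g(\infty))$ with $D=\sum_{j=1}^g(Q_j)$, $Q_j=(c_j,V_{\mathfrak{r}}(c_j))\in\mathcal{C}(K)$, where $c_1,\dots,c_g$ are the roots of $U_{\mathfrak{r}}$ with multiplicities. One has $2\mathfrak{a}_{\mathfrak{r}}=P$, and $\mathfrak{r}\mapsto\mathfrak{a}_{\mathfrak{r}}$ is a bijection from $\mathfrak{R}_{1/2,P}$ onto the set of $\mathfrak{a}\in J(K)$ with $2\mathfrak{a}=P$.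 *)

theory Defs
  imports "HOL-Computational_Algebra.Computational_Algebra" "HOL-Library.Poly_Mapping" "HOL-Library.FuncSet"
begin

definition is_subfield :: "'a::field set \<Rightarrow> bool" where
  "is_subfield K0 \<longleftrightarrow> 0 \<in> K0 \<and> 1 \<in> K0 \<and>
     (\<forall>x\<in>K0. \<forall>y\<in>K0. x + y \<in> K0 \<and> x * y \<in> K0) \<and>
     (\<forall>x\<in>K0. - x \<in> K0 \<and> inverse x \<in> K0)"

definition polys_over :: "'a::zero set \<Rightarrow> 'a poly set" where
  "polys_over K0 = {p. \<forall>i. coeff p i \<in> K0}"

definition hyp_poly :: "nat \<Rightarrow> (nat \<Rightarrow> 'a::field) \<Rightarrow> 'a poly" where
  "hyp_poly g \<alpha> = (\<Prod>i=1..2*g+1. [:- \<alpha> i, 1:])"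


section \<open>The curve and its functions\<close>

text \<open>
  Everything in this section and the next is meant for a separable polynomial \<open>f\<close> of odd degree
  \<open>2g+1\<close> over an algebraically closed field of characteristic different from 2. The affine curve
  \<open>y^2 = f(x)\<close> is then smooth, and the smooth projective model has exactly one further point.
\<close>

datatype 'a cpoint = Infty | Aff 'a 'a

definition curve :: "'a::field poly \<Rightarrow> 'a cpoint set" where
  "curve f = insert Infty {Aff a b | a b. b ^ 2 = poly f a}"

text \<open>
  A bivariate polynomial is an element of \<open>K[x][y]\<close>, i.e. the inner variable is \<open>x\<close> and the outer
  one is \<open>y\<close>. The coordinate ring of the affine curve is \<open>K[x][y]/(y^2 - f)\<close>; each of its elements
  has a unique representative \<open>p(x) + q(x) y\<close>, i.e. one of degree at most 1 in \<open>y\<close>. The elements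
  of the function field are the quotients \<open>F/G\<close> of such functions, and those of \<open>K0(C)\<close> are the
  quotients with \<open>F\<close> and \<open>G\<close> having coefficients in \<open>K0\<close>.
\<close>

definition eval2 :: "'a::comm_ring_1 poly poly \<Rightarrow> 'a \<Rightarrow> 'a \<Rightarrow> 'a" where
  "eval2 F a b = poly (poly F [:b:]) a"

definition eq_on_curve :: "'a::field poly \<Rightarrow> 'a poly poly \<Rightarrow> 'a poly poly \<Rightarrow> bool" where
  "eq_on_curve f F G \<longleftrightarrow> [:- f, 0, 1:] dvd F - G"

definition coord_funs :: "'a::zero poly poly set" where
  "coord_funs = {F. degree F \<le> 1}"

definition coord_funs_over :: "'a::zero set \<Rightarrow> 'a poly poly set" where
  "coord_funs_over K0 = {F \<in> coord_funs. \<forall>i. coeff F i \<in> polys_over K0}"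

text \<open>A uniformizer at the affine point \<open>(a, b)\<close>: \<open>x - a\<close>, or \<open>y\<close> if the point is a Weierstrass point.\<close>

definition uniformizer :: "'a::field \<Rightarrow> 'a \<Rightarrow> 'a poly poly" where
  "uniformizer a b = (if b = 0 then [:0, 1:] else [:[:- a, 1:]:])"

text \<open>
  Order of vanishing of a nonzero element \<open>F\<close> of \<open>coord_funs\<close> at a point of the curve. At an affine
  point with uniformizer \<open>t\<close> it is the \<open>n\<close> with \<open>F = t^n u/v\<close> in the function field, where
  \<open>u\<close> and \<open>v\<close> do not vanish at the point. At infinity, \<open>x\<close> has a pole of order 2 and \<open>y\<close> one of
  order \<open>degree f\<close>; as the latter is odd, the two summands of \<open>p(x) + q(x) y\<close> have poles of
  different orders.
\<close>

fun ord_at :: "'a::field poly \<Rightarrow> 'a cpoint \<Rightarrow> 'a poly poly \<Rightarrow> int" where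
  "ord_at f (Aff a b) F =
     int (THE n. \<exists>u v. eval2 u a b \<noteq> 0 \<and> eval2 v a b \<noteq> 0 \<and>
                       eq_on_curve f (v * F) (uniformizer a b ^ n * u))"
| "ord_at f Infty F =
     - int (if coeff F 1 = 0 then 2 * degree (coeff F 0)
            else max (2 * degree (coeff F 0)) (2 * degree (coeff F 1) + degree f))"


section \<open>Divisors and the jacobian\<close>

type_synonym 'a divisor = "'a cpoint \<Rightarrow>\<^sub>0 int"

definition div_degree :: "'a divisor \<Rightarrow> int" where
  "div_degree D = (\<Sum>P\<in>Poly_Mapping.keys D. Poly_Mapping.lookup D P)"

definition Div0 :: "'a::field poly \<Rightarrow> 'a divisor set" where
  "Div0 f = {D. Poly_Mapping.keys D \<subseteq> curve f \<and> div_degree D = 0}"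

definition principal :: "'a::field poly \<Rightarrow> 'a divisor \<Rightarrow> bool" where
  "principal f D \<longleftrightarrow> Poly_Mapping.keys D \<subseteq> curve f \<and>
     (\<exists>F\<in>coord_funs. \<exists>G\<in>coord_funs. F \<noteq> 0 \<and> G \<noteq> 0 \<and>
        (\<forall>P\<in>curve f. Poly_Mapping.lookup D P = ord_at f P F - ord_at f P G))"

definition lin_equiv :: "'a::field poly \<Rightarrow> ('a divisor \<times> 'a divisor) set" where
  "lin_equiv f = {(D, E). D \<in> Div0 f \<and> E \<in> Div0 f \<and> principal f (D - E)}"

definition jacobian :: "'a::field poly \<Rightarrow> 'a divisor set set" where
  "jacobian f = Div0 f // lin_equiv f"

definition cl :: "'a::field poly \<Rightarrow> 'a divisor \<Rightarrow> 'a divisor set" where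
  "cl f D = lin_equiv f `` {D}"

text \<open>
  The nonempty open sets below form a basis of the \<open>K0\<close>-Zariski topology of the projective curve:
  the nonvanishing locus of a function in the affine coordinate ring over \<open>K0\<close>, with or without
  the (\<open>K0\<close>-rational) point at infinity.
\<close>

definition basic_open :: "'a::field poly \<Rightarrow> 'a set \<Rightarrow> 'a cpoint set \<Rightarrow> bool" where
  "basic_open f K0 N \<longleftrightarrow> (\<exists>H\<in>coord_funs_over K0. H \<noteq> 0 \<and>
     (let A = {Aff a b | a b. Aff a b \<in> curve f \<and> eval2 H a b \<noteq> 0}
      in N = A \<or> N = insert Infty A))"

text \<open>
  A divisor is defined over \<open>K0\<close> if it is a (Cartier) divisor of the curve over \<open>K0\<close>: locally in
  the \<open>K0\<close>-Zariski topology it is the divisor of a nonzero element of \<open>K0(C)\<close>. Unlike invariance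
  under automorphisms of \<open>K\<close> over \<open>K0\<close>, this is also correct for imperfect \<open>K0\<close>.
\<close>

definition div_defined_over :: "'a::field poly \<Rightarrow> 'a set \<Rightarrow> 'a divisor \<Rightarrow> bool" where
  "div_defined_over f K0 D \<longleftrightarrow> Poly_Mapping.keys D \<subseteq> curve f \<and>
     (\<forall>P\<in>curve f. \<exists>N. basic_open f K0 N \<and> P \<in> N \<and>
        (\<exists>F\<in>coord_funs_over K0. \<exists>G\<in>coord_funs_over K0. F \<noteq> 0 \<and> G \<noteq> 0 \<and>
           (\<forall>Q\<in>N. Poly_Mapping.lookup D Q = ord_at f Q F - ord_at f Q G)))"

text \<open>
  \<open>J(K0)\<close>. As the curve has a \<open>K0\<close>-rational point (infinity), the jacobian represents the degree 0
  Picard functor of the curve over \<open>K0\<close>, so its \<open>K0\<close>-points are the classes of degree 0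
  divisors that are defined over \<open>K0\<close>.
\<close>

definition jacobian_over :: "'a::field poly \<Rightarrow> 'a set \<Rightarrow> 'a divisor set set" where
  "jacobian_over f K0 = {cl f D | D. D \<in> Div0 f \<and> div_defined_over f K0 D}"

definition mumford_point :: "'a::field poly \<Rightarrow> 'a poly \<Rightarrow> 'a poly \<Rightarrow> 'a divisor set" where
  "mumford_point f U V =
     cl f ((\<Sum>c | poly U c = 0. Poly_Mapping.single (Aff c (poly V c)) (int (order c U)))
           - Poly_Mapping.single Infty (int (degree U)))"


section \<open>Halves of a point\<close>

definition elem_sym :: "nat \<Rightarrow> (nat \<Rightarrow> 'a::comm_ring_1) \<Rightarrow> nat \<Rightarrow> 'a" where
  "elem_sym n r i = (\<Sum>A | A \<subseteq> {1..n} \<and> card A = i. \<Prod>k\<in>A. r k)"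

definition half_tuples :: "nat \<Rightarrow> (nat \<Rightarrow> 'a::field) \<Rightarrow> 'a \<Rightarrow> 'a \<Rightarrow> (nat \<Rightarrow> 'a) set" where
  "half_tuples g \<alpha> a b = {r \<in> {1..2*g+1} \<rightarrow>\<^sub>E UNIV.
     (\<forall>i\<in>{1..2*g+1}. r i ^ 2 = a - \<alpha> i) \<and> (\<Prod>i=1..2*g+1. r i) = - b}"

definition h_poly :: "nat \<Rightarrow> (nat \<Rightarrow> 'a::field) \<Rightarrow> 'a poly" where
  "h_poly g r = (\<Prod>i=1..2*g+1. [:- r i, 1:])"

definition U_poly :: "nat \<Rightarrow> 'a::field \<Rightarrow> (nat \<Rightarrow> 'a) \<Rightarrow> 'a poly" where
  "U_poly g a r = (-1) ^ g *
     ([:a, -1:] ^ g + (\<Sum>j=1..g. smult (elem_sym (2*g+1) r (2*j)) ([:a, -1:] ^ (g - j))))"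

definition V_poly :: "nat \<Rightarrow> 'a::field \<Rightarrow> 'a \<Rightarrow> (nat \<Rightarrow> 'a) \<Rightarrow> 'a poly" where
  "V_poly g a b r =
     (\<Sum>j=1..g. smult (elem_sym (2*g+1) r (2*j - 1)) ([:a, -1:] ^ (g - j + 1))) - [:b:]
     - smult (elem_sym (2*g+1) r 1)
         ([:a, -1:] ^ g + (\<Sum>j=1..g. smult (elem_sym (2*g+1) r (2*j)) ([:a, -1:] ^ (g - j))))"

definition half_point :: "nat \<Rightarrow> (nat \<Rightarrow> 'a::field) \<Rightarrow> 'a \<Rightarrow> 'a \<Rightarrow> (nat \<Rightarrow> 'a) \<Rightarrow> 'a divisor set" where
  "half_point g \<alpha> a b r = mumford_point (hyp_poly g \<alpha>) (U_poly g a r) (V_poly g a b r)"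

end

theory Submission
  imports Defs
begin

text \<open>
Write \<open>K[C]\<close> for the ring of functions \<open>p + q y\<close> on the affine curve and \<open>D\<close> for the effective divisor
cut out by \<open>(U, V)\<close>, so that the half of \<open>P\<close> is the class of \<open>D - g\<infinity>\<close>. The proof has two halves: the
class is rational over \<open>K0\<close> iff \<open>U\<close> and \<open>V\<close> have coefficients in \<open>K0\<close>, and this holds iff the
elementary symmetric functions \<open>s i\<close> of \<open>r\<close> lie in \<open>K0\<close>.

\<^bold>\<open>Rationality of Mumford pairs\<close> (\<open>mumford_point_over_iff\<close>). If \<open>U\<close> and \<open>V\<close> are over \<open>K0\<close>, then \<open>D\<close> has
the local equation \<open>U\<close> on the open set \<open>y + V \<noteq> 0\<close>, which contains it, and \<open>1\<close> away from its support. For the converse, suppose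
that a divisor \<open>E\<close> over \<open>K0\<close> lies in the class. Classically one would say that the space of functions with
poles bounded by \<open>E + g\<infinity>\<close> is a line, and is defined over \<open>K0\<close>. In place of descent theory, the argument
here applies a \<open>K0\<close>-linear projection \<open>K \<rightarrow> K0\<close> to the coefficients of functions. Such a projection is
linear over \<open>K0[C]\<close>, and therefore preserves divisibility, in all local rings of a \<open>K0\<close>-open
set, by a function over \<open>K0\<close> (\<open>projpp_loc_dvd\<close>). Multiply the function with divisor \<open>D - g\<infinity> - E\<close> by
a polynomial \<open>m\<close> over \<open>K0\<close> that clears its poles; the product \<open>T\<close> is in \<open>K[C]\<close> with divisor
\<open>D + div m - E\<close> at the finite points, and can be scaled to have a coefficient 1. Its projection \<open>T'\<close>
is then nonzero, has orders at least those of \<open>div m - E\<close>, and has no larger pole at infinity than \<open>T\<close>.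
So \<open>T'/T\<close> has poles at most \<open>D\<close>, which forces it to be constant (\<open>proportional_of_ord_ge\<close>). Hence \<open>T'\<close>
has the same divisor as \<open>T\<close>, so that \<open>D\<close> itself has local equations over \<open>K0\<close>, and the projection
maps functions vanishing on \<open>D\<close> to functions vanishing on \<open>D\<close> (\<open>vanishes_projpp\<close>). Applied to \<open>U\<close> and
\<open>y - V\<close> it changes them by polynomials in \<open>x\<close> that vanish on \<open>D\<close>, that is, by multiples of \<open>U\<close>, of degree less
than that of \<open>U\<close>. So it fixes them.

\<^bold>\<open>Algebra of halves.\<close> Put \<open>t\<^sup>2 = a - x\<close>. Sorting the coefficients of \<open>h(t) = \<Prod>(t - r i)\<close> by parity gives
\<open>h(t) = t A(t\<^sup>2) - B(t\<^sup>2)\<close>, and \<open>h(t) h(-t) = \<Prod>(r i\<^sup>2 - t\<^sup>2) = f(a - t\<^sup>2)\<close>. As \<open>U = (-1)^g A(a - x)\<close>, this reads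
\<open>f = V'\<^sup>2 + (x - a) U\<^sup>2\<close> with \<open>V' = B(a - x)\<close>, and \<open>V = V' - \<kappa> U\<close> with \<open>\<kappa> = (-1)^g s 1\<close>. A common root of
\<open>U\<close> and \<open>V\<close> would be a double root of \<open>f\<close>; so \<open>D\<close> avoids the branch points. If \<open>U\<close> and \<open>V\<close> are
over \<open>K0\<close>, then so is \<open>(f - V\<^sup>2) / U = 2 \<kappa> V + \<kappa>\<^sup>2 U + (x - a) U\<close>, whose coefficients yield first \<open>\<kappa>\<^sup>2\<close> and then
\<open>\<kappa>\<close>, hence \<open>V'\<close>, \<open>A\<close>, \<open>B\<close> and all \<open>s i\<close>.
\<close>

section \<open>Coefficientwise projection onto a subfield\<close>

locale subfield_projection =
  fixes K0 :: "'a::field set" and L :: "'a \<Rightarrow> 'a"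
  assumes subfield: "is_subfield K0"
    and proj_add: "L (x + y) = L x + L y"
    and proj_scale: "c \<in> K0 \<Longrightarrow> L (c * x) = c * L x"
    and proj_in: "L x \<in> K0"
    and proj_id: "c \<in> K0 \<Longrightarrow> L c = c"

text \<open>
A complement of \<open>K0\<close> in the \<open>K0\<close>-vector space \<open>K\<close> is a \<open>K0\<close>-subspace that is maximal among those
not containing 1; the projection along it is the required map.
\<close>

lemma subfield_projection_exists:
  fixes K0 :: "'a::field set"
  assumes sf: "is_subfield K0"
  shows "\<exists>L. subfield_projection K0 L"
proof -
  have K: "0 \<in> K0" "1 \<in> K0" "\<And>x y. x \<in> K0 \<Longrightarrow> y \<in> K0 \<Longrightarrow> x + y \<in> K0"
    "\<And>x y. x \<in> K0 \<Longrightarrow> y \<in> K0 \<Longrightarrow> x * y \<in> K0" "\<And>x. x \<in> K0 \<Longrightarrow> - x \<in> K0"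
    "\<And>x. x \<in> K0 \<Longrightarrow> inverse x \<in> K0"
    using sf by (auto simp: is_subfield_def)
  define subsp where "subsp W \<longleftrightarrow> 0 \<in> W \<and> (\<forall>x\<in>W. \<forall>y\<in>W. x + y \<in> W) \<and> (\<forall>c\<in>K0. \<forall>x\<in>W. c * x \<in> W)"
    for W :: "'a set"
  define \<W> where "\<W> = {W. subsp W \<and> 1 \<notin> W}"
  have "\<exists>W\<in>\<W>. \<forall>X\<in>\<W>. W \<subseteq> X \<longrightarrow> X = W"
  proof (rule subset_Zorn_nonempty)
    have "{0} \<in> \<W>" by (auto simp: \<W>_def subsp_def)
    then show "\<W> \<noteq> {}" by blast
  next
    fix C assume C: "C \<noteq> {}" "subset.chain \<W> C"
    have sub: "W \<in> \<W>" if "W \<in> C" for W using C that by (auto simp: subset.chain_def)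
    have chain: "X \<subseteq> Y \<or> Y \<subseteq> X" if "X \<in> C" "Y \<in> C" for X Y
      using C that by (auto simp: subset.chain_def)
    have "x + y \<in> \<Union>C" if xy: "x \<in> \<Union>C" "y \<in> \<Union>C" for x y
    proof -
      obtain X Y where XY: "X \<in> C" "Y \<in> C" "x \<in> X" "y \<in> Y" using xy by blast
      then have "(x \<in> X \<and> y \<in> X) \<or> (x \<in> Y \<and> y \<in> Y)" using chain by blast
      moreover have "subsp X" "subsp Y" using sub XY by (auto simp: \<W>_def)
      ultimately show ?thesis using XY unfolding subsp_def by blast
    qed
    moreover have "0 \<in> \<Union>C" using C sub by (auto simp: \<W>_def subsp_def)
    moreover have "c * x \<in> \<Union>C" if "c \<in> K0" "x \<in> \<Union>C" for c x
      using that sub by (fastforce simp: \<W>_def subsp_def)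
    moreover have "1 \<notin> \<Union>C" using sub by (auto simp: \<W>_def)
    ultimately show "\<Union>C \<in> \<W>" by (simp add: \<W>_def subsp_def)
  qed
  then obtain W where W: "subsp W" "1 \<notin> W"
    and max: "\<And>X. subsp X \<Longrightarrow> 1 \<notin> X \<Longrightarrow> W \<subseteq> X \<Longrightarrow> X = W"
    unfolding \<W>_def by blast
  have W0: "0 \<in> W" and Wadd: "\<And>x y. x \<in> W \<Longrightarrow> y \<in> W \<Longrightarrow> x + y \<in> W"
    and Wscale: "\<And>c x. c \<in> K0 \<Longrightarrow> x \<in> W \<Longrightarrow> c * x \<in> W"
    using W unfolding subsp_def by blast+
  have Wneg: "- x \<in> W" if "x \<in> W" for x
    using Wscale[of "-1" x] K that by simp
  have ex: "\<exists>c. c \<in> K0 \<and> x - c \<in> W" for x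
  proof (cases "x \<in> W")
    case True
    then show ?thesis using K by (intro exI[of _ 0]) auto
  next
    case False
    \<comment> \<open>By maximality \<open>W + K0 x\<close> contains 1.\<close>
    define X where "X = {w + k * x | w k. w \<in> W \<and> k \<in> K0}"
    have "subsp X" unfolding subsp_def
    proof (intro conjI ballI)
      show "0 \<in> X" unfolding X_def using W0 K by (intro CollectI exI[of _ 0]) auto
    next
      fix u v assume "u \<in> X" "v \<in> X"
      then obtain w k w' k' where "u = w + k * x" "v = w' + k' * x" "w \<in> W" "w' \<in> W" "k \<in> K0" "k' \<in> K0"
        unfolding X_def by blast
      then show "u + v \<in> X" unfolding X_def using Wadd K
        by (intro CollectI exI[of _ "w + w'"] exI[of _ "k + k'"]) (auto simp: algebra_simps)
    next
      fix c u assume "c \<in> K0" "u \<in> X"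
      then obtain w k where "u = w + k * x" "w \<in> W" "k \<in> K0"
        unfolding X_def by blast
      then show "c * u \<in> X" unfolding X_def using Wscale K \<open>c \<in> K0\<close>
        by (intro CollectI exI[of _ "c * w"] exI[of _ "c * k"]) (auto simp: algebra_simps)
    qed
    moreover have "W \<subseteq> X" 
    proof
      fix w assume "w \<in> W"
      then show "w \<in> X" unfolding X_def using K by (intro CollectI exI[of _ w] exI[of _ 0]) simp
    qed
    moreover have "x \<in> X" unfolding X_def using K W0
      by (intro CollectI exI[of _ 0] exI[of _ 1]) auto
    ultimately have "1 \<in> X" using max False by blast
    then obtain w k where wk: "1 = w + k * x" "w \<in> W" "k \<in> K0" unfolding X_def by blast
    have k: "k \<noteq> 0" using wk W by auto
    have w: "w = 1 - k * x" using wk(1) by (metis add_diff_cancel_right')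
    have "x - inverse k = inverse k * (- w)"
      unfolding w using k by (simp add: right_diff_distrib mult.assoc[symmetric])
    moreover have "inverse k * (- w) \<in> W" by (intro Wscale Wneg K wk)
    ultimately have "x - inverse k \<in> W" by simp
    then show ?thesis using K(6)[OF wk(3)] by blast
  qed
  \<comment> \<open>As \<open>W\<close> is closed under scaling by \<open>K0\<close>, a nonzero element of \<open>K0\<close> in \<open>W\<close> would put 1 in \<open>W\<close>.\<close>
  have uniq: "c = d" if "c \<in> K0" "d \<in> K0" "x - c \<in> W" "x - d \<in> W" for x c d
  proof (rule ccontr)
    assume "c \<noteq> d"
    have "(x - c) + - (x - d) \<in> W" by (intro Wadd Wneg that)
    then have "d - c \<in> W" by simp
    moreover have "d + - c \<in> K0" by (intro K that)
    ultimately have "inverse (d + - c) * (d - c) \<in> W" by (intro Wscale K(6))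
    then show False using W \<open>c \<noteq> d\<close> by simp
  qed
  define L where "L x = (THE c. c \<in> K0 \<and> x - c \<in> W)" for x
  have L: "L x \<in> K0" "x - L x \<in> W" for x
  proof -
    have "\<exists>!c. c \<in> K0 \<and> x - c \<in> W" using ex[of x] uniq[of _ _ x] by blast
    from theI'[OF this] show "L x \<in> K0" "x - L x \<in> W" unfolding L_def by blast+
  qed
  have Leq: "L x = c" if "c \<in> K0" "x - c \<in> W" for x c
    using uniq L that by blast
  have "subfield_projection K0 L"
  proof
    show "L (x + y) = L x + L y" for x y
    proof (rule Leq)
      have "(x - L x) + (y - L y) \<in> W" by (intro L Wadd)
      then show "x + y - (L x + L y) \<in> W" by (simp add: algebra_simps)
    qed (intro L K)
    show "L (c * x) = c * L x" if "c \<in> K0" for c x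
    proof (rule Leq)
      have "c * (x - L x) \<in> W" by (intro L Wscale that)
      then show "c * x - c * L x \<in> W" by (simp add: algebra_simps)
    qed (intro L K that)
    show "L c = c" if "c \<in> K0" for c by (rule Leq) (use that W0 in auto)
  qed (use L sf in auto)
  then show ?thesis by blast
qed

lemma map_poly_add:
  fixes h :: "'b::ab_group_add \<Rightarrow> 'b"
  assumes "\<And>x y. h (x + y) = h x + h y"
  shows "map_poly h (p + q) = map_poly h p + map_poly h q"
proof -
  have h0: "h 0 = 0" using assms[of 0 0] by simp
  show ?thesis by (intro poly_eqI) (simp add: coeff_map_poly h0 assms)
qed

text \<open>
Used at two levels: for the projection on \<open>K\<close> acting on \<open>K[x]\<close>, and for the resulting map on
\<open>K[x]\<close> acting on \<open>K[x][y]\<close>.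
\<close>

lemma map_poly_semilinear:
  fixes h :: "'b::comm_ring_1 \<Rightarrow> 'b"
  assumes add: "\<And>x y. h (x + y) = h x + h y"
    and scale: "\<And>c x. c \<in> S \<Longrightarrow> h (c * x) = c * h x"
    and p: "\<And>i. coeff p i \<in> S"
  shows "map_poly h (p * q) = p * map_poly h q"
proof -
  have h0: "h 0 = 0" using add[of 0 0] by simp
  have hsum: "h (sum g A) = (\<Sum>i\<in>A. h (g i))" if "finite A" for g and A :: "nat set"
    using that by (induction A) (simp_all add: h0 add)
  show ?thesis
    by (intro poly_eqI) (simp add: coeff_map_poly h0 coeff_mult hsum scale p)
qed

context subfield_projection
begin

lemma sub_closed: "0 \<in> K0" "1 \<in> K0" "x \<in> K0 \<Longrightarrow> y \<in> K0 \<Longrightarrow> x + y \<in> K0"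
    "x \<in> K0 \<Longrightarrow> y \<in> K0 \<Longrightarrow> x * y \<in> K0" "x \<in> K0 \<Longrightarrow> - x \<in> K0" "x \<in> K0 \<Longrightarrow> inverse x \<in> K0"
    "x \<in> K0 \<Longrightarrow> y \<in> K0 \<Longrightarrow> x - y \<in> K0" "x \<in> K0 \<Longrightarrow> x ^ n \<in> K0"
proof -
  have *: "0 \<in> K0" "1 \<in> K0" "\<And>x y. x \<in> K0 \<Longrightarrow> y \<in> K0 \<Longrightarrow> x + y \<in> K0"
    "\<And>x y. x \<in> K0 \<Longrightarrow> y \<in> K0 \<Longrightarrow> x * y \<in> K0" "\<And>x. x \<in> K0 \<Longrightarrow> - x \<in> K0"
    "\<And>x. x \<in> K0 \<Longrightarrow> inverse x \<in> K0"
    using subfield by (auto simp: is_subfield_def)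
  show "0 \<in> K0" "1 \<in> K0" by (fact *)+
  show "x \<in> K0 \<Longrightarrow> y \<in> K0 \<Longrightarrow> x + y \<in> K0" by (rule *)
  show "x \<in> K0 \<Longrightarrow> y \<in> K0 \<Longrightarrow> x * y \<in> K0" by (rule *)
  show "x \<in> K0 \<Longrightarrow> - x \<in> K0" by (rule *)
  show "x \<in> K0 \<Longrightarrow> inverse x \<in> K0" by (rule *)
  show "x \<in> K0 \<Longrightarrow> y \<in> K0 \<Longrightarrow> x - y \<in> K0" using *(3)[OF _ *(5), of x y] by simp
  show "x \<in> K0 \<Longrightarrow> x ^ n \<in> K0" by (induction n) (simp_all add: *)
qed

lemma sub_sum: "(\<And>i. i \<in> A \<Longrightarrow> h i \<in> K0) \<Longrightarrow> sum h A \<in> K0"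
  by (induction A rule: infinite_finite_induct) (simp_all add: sub_closed)

abbreviation polys0 where "polys0 \<equiv> polys_over K0"

lemma polys0_closed: "0 \<in> polys0" "1 \<in> polys0" "p \<in> polys0 \<Longrightarrow> q \<in> polys0 \<Longrightarrow> p + q \<in> polys0"
  "p \<in> polys0 \<Longrightarrow> q \<in> polys0 \<Longrightarrow> p - q \<in> polys0"
  "p \<in> polys0 \<Longrightarrow> q \<in> polys0 \<Longrightarrow> p * q \<in> polys0" "p \<in> polys0 \<Longrightarrow> - p \<in> polys0"
  "p \<in> polys0 \<Longrightarrow> p ^ n \<in> polys0"
  "c \<in> K0 \<Longrightarrow> p \<in> polys0 \<Longrightarrow> pCons c p \<in> polys0"
  "c \<in> K0 \<Longrightarrow> p \<in> polys0 \<Longrightarrow> smult c p \<in> polys0"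
proof -
  have mult: "p * q \<in> polys0" if "p \<in> polys0" "q \<in> polys0" for p q
    using that by (auto simp: polys_over_def coeff_mult intro!: sub_sum sub_closed)
  have one: "1 \<in> polys0" by (auto simp: polys_over_def coeff_1 sub_closed)
  show "p \<in> polys0 \<Longrightarrow> q \<in> polys0 \<Longrightarrow> p * q \<in> polys0" "1 \<in> polys0" by fact+
  show "p \<in> polys0 \<Longrightarrow> p ^ n \<in> polys0" by (induction n) (simp_all add: mult one)
  show "0 \<in> polys0" by (simp add: polys_over_def sub_closed)
  show "p \<in> polys0 \<Longrightarrow> q \<in> polys0 \<Longrightarrow> p + q \<in> polys0" by (simp add: polys_over_def sub_closed)
  show "p \<in> polys0 \<Longrightarrow> q \<in> polys0 \<Longrightarrow> p - q \<in> polys0" by (simp add: polys_over_def sub_closed)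
  show "p \<in> polys0 \<Longrightarrow> - p \<in> polys0" by (simp add: polys_over_def sub_closed)
  show "c \<in> K0 \<Longrightarrow> p \<in> polys0 \<Longrightarrow> pCons c p \<in> polys0"
    by (simp add: polys_over_def coeff_pCons split: nat.splits)
  show "c \<in> K0 \<Longrightarrow> p \<in> polys0 \<Longrightarrow> smult c p \<in> polys0" by (simp add: polys_over_def sub_closed)
qed

lemma polys0_sum: "(\<And>i. i \<in> A \<Longrightarrow> h i \<in> polys0) \<Longrightarrow> sum h A \<in> polys0"
  by (induction A rule: infinite_finite_induct) (simp_all add: polys0_closed)

lemma polys0_prod: "(\<And>i. i \<in> A \<Longrightarrow> h i \<in> polys0) \<Longrightarrow> prod h A \<in> polys0"
  by (induction A rule: infinite_finite_induct) (simp_all add: polys0_closed)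

lemma proj_0: "L 0 = 0" by (simp add: proj_id sub_closed)

definition projp :: "'a poly \<Rightarrow> 'a poly" where "projp = map_poly L"
definition projpp :: "'a poly poly \<Rightarrow> 'a poly poly" where "projpp = map_poly projp"

lemma coeff_projp: "coeff (projp p) i = L (coeff p i)"
  by (simp add: projp_def coeff_map_poly proj_0)

lemma projp_0 [simp]: "projp 0 = 0" by (simp add: projp_def)

lemma coeff_projpp: "coeff (projpp F) i = projp (coeff F i)"
  by (simp add: projpp_def coeff_map_poly)

lemma projp_add: "projp (p + q) = projp p + projp q"
  by (simp add: projp_def map_poly_add proj_add)

lemma projpp_add: "projpp (F + G) = projpp F + projpp G"
  by (simp add: projpp_def map_poly_add projp_add)

lemma projp_mult: "p \<in> polys0 \<Longrightarrow> projp (p * q) = p * projp q"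
  unfolding projp_def
  by (rule map_poly_semilinear[where S = K0]) (auto simp: proj_add proj_scale polys_over_def)

lemma projpp_mult: "(\<And>i. coeff F i \<in> polys0) \<Longrightarrow> projpp (F * G) = F * projpp G"
  unfolding projpp_def
  by (rule map_poly_semilinear[where S = polys0]) (auto simp: projp_add projp_mult)

lemma projp_in: "projp p \<in> polys0" by (simp add: polys_over_def coeff_projp proj_in)

lemma projp_id: "p \<in> polys0 \<Longrightarrow> projp p = p"
  by (intro poly_eqI) (simp add: coeff_projp proj_id polys_over_def)

lemma projp_fixed_imp: "projp p = p \<Longrightarrow> p \<in> polys0" using projp_in[of p] by simp

lemma projpp_coeff_in: "coeff (projpp F) i \<in> polys0" by (simp add: coeff_projpp projp_in)

lemma degree_projp: "degree (projp p) \<le> degree p"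
  by (simp add: projp_def map_poly_degree_leq)

lemma degree_projpp: "degree (projpp p) \<le> degree p"
  by (simp add: projpp_def map_poly_degree_leq)

text \<open>
The projection commutes with multiplication by \<open>p\<close>, so it fixes \<open>q\<close> as soon as it fixes \<open>p\<close> and \<open>p * q\<close>.
\<close>

lemma projp_quotient:
  assumes "p \<in> polys0" "p \<noteq> 0" "p * q \<in> polys0"
  shows "q \<in> polys0"
proof -
  have "p * projp q = p * q" by (rule trans[OF projp_mult[OF assms(1), symmetric] projp_id[OF assms(3)]])
  then have "projp q = q" using assms(2) mult_cancel_left by blast
  then show ?thesis by (rule projp_fixed_imp)
qed

end

section \<open>The coordinate ring and its norm\<close>

lemma eval2_simps [simp]:
  "eval2 0 a b = 0" "eval2 1 a b = 1"
  "eval2 (F + G) a b = eval2 F a b + eval2 G a b"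
  "eval2 (F - G) a b = eval2 F a b - eval2 G a b"
  "eval2 (- F) a b = - eval2 F a b"
  "eval2 (F * G) a b = eval2 F a b * eval2 G a b"
  "eval2 (F ^ n) a b = eval2 F a b ^ n"
  "eval2 [:p:] a b = poly p a"
  "eval2 [:p, q:] a b = poly p a + b * poly q a"
  "eval2 [:p, q, r:] a b = poly p a + b * poly q a + b\<^sup>2 * poly r a"
proof -
  show "eval2 [:p, q, r:] a b = poly p a + b * poly q a + b\<^sup>2 * poly r a"
    by (simp add: eval2_def power2_eq_square algebra_simps)
  show "eval2 (F ^ n) a b = eval2 F a b ^ n" by (induction n) (simp_all add: eval2_def)
qed (simp_all add: eval2_def algebra_simps)

locale odd_curve =
  fixes f :: "'a::alg_closed_field poly"
  assumes odd_degree: "odd (degree f)"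
    and squarefree: "rsquarefree f"
    and two_neq_0: "(2::'a) \<noteq> 0"
begin

abbreviation eqc :: "'a poly poly \<Rightarrow> 'a poly poly \<Rightarrow> bool" (infix "\<simeq>" 50)
  where "F \<simeq> G \<equiv> eq_on_curve f F G"

lemma eqc_refl [simp, intro]: "F \<simeq> F" by (simp add: eq_on_curve_def)

lemma eqc_sym: "F \<simeq> G \<Longrightarrow> G \<simeq> F"
  unfolding eq_on_curve_def by (subst dvd_minus_iff[symmetric]) simp

lemma eqc_trans [trans]: "F \<simeq> G \<Longrightarrow> G \<simeq> H \<Longrightarrow> F \<simeq> H"
  unfolding eq_on_curve_def using dvd_add[of _ "F - G" "G - H"] by simp

lemma eqc_add: "F \<simeq> G \<Longrightarrow> F' \<simeq> G' \<Longrightarrow> F + F' \<simeq> G + G'"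
  unfolding eq_on_curve_def using dvd_add[of _ "F - G" "F' - G'"] by (simp add: algebra_simps)

lemma eqc_mult: "F \<simeq> G \<Longrightarrow> F' \<simeq> G' \<Longrightarrow> F * F' \<simeq> G * G'"
  unfolding eq_on_curve_def
  using dvd_add[OF dvd_mult2[of _ "F - G" F'] dvd_mult[of _ "F' - G'" G]] by (simp add: algebra_simps)

lemma eqc_diff: "F \<simeq> G \<Longrightarrow> F' \<simeq> G' \<Longrightarrow> F - F' \<simeq> G - G'"
  unfolding eq_on_curve_def using dvd_diff[of _ "F - G" "F' - G'"] by (simp add: algebra_simps)

lemma eqc_power: "F \<simeq> G \<Longrightarrow> F ^ n \<simeq> G ^ n"
  by (induction n) (auto intro: eqc_mult)

lemma eqc_iff_diff: "F \<simeq> G \<longleftrightarrow> F - G \<simeq> 0"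
  by (simp add: eq_on_curve_def)

lemma eqc_eval2:
  assumes "F \<simeq> G" "b\<^sup>2 = poly f a" shows "eval2 F a b = eval2 G a b"
proof -
  obtain H where "F - G = [:- f, 0, 1:] * H" using assms(1) by (auto simp: eq_on_curve_def)
  then have "eval2 (F - G) a b = eval2 [:- f, 0, 1:] a b * eval2 H a b" by (simp only: eval2_simps)
  then have "eval2 (F - G) a b = 0" using assms(2) by simp
  then show ?thesis by simp
qed

lemma y_squared: "[:0, 1:] * [:0, 1:] \<simeq> [:f:]"
  unfolding eq_on_curve_def by simp

lemma reduced_eq_pair: "F \<in> coord_funs \<Longrightarrow> F = [:coeff F 0, coeff F 1:]"
  by (intro poly_eqI)
     (auto simp: coord_funs_def coeff_pCons coeff_eq_0 split: nat.splits)

lemma pair_in_coord_funs [simp]: "[:p, q:] \<in> coord_funs" "[:p:] \<in> coord_funs"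
  by (auto simp: coord_funs_def)

text \<open>
Repeatedly replacing \<open>y\<^sup>2\<close> by \<open>f\<close> brings every bivariate polynomial to degree at most 1 in \<open>y\<close>.
\<close>

lemma reduced_exists: "\<exists>G\<in>coord_funs. F \<simeq> G"
proof (induction F)
  case 0
  then show ?case by (intro bexI[of _ 0]) (auto simp: coord_funs_def)
next
  case (pCons c F)
  then obtain G where G: "G \<in> coord_funs" "F \<simeq> G" by blast
  define p q where "p = coeff G 0" and "q = coeff G 1"
  have Geq: "G = [:p, q:]" using reduced_eq_pair[OF G(1)] by (simp add: p_def q_def)
  have "pCons c F = [:c:] + [:0, 1:] * F" by simp
  also have "\<dots> \<simeq> [:c:] + [:0, 1:] * G" by (intro eqc_add eqc_mult eqc_refl G)
  also have "\<dots> = [:c, p:] + [:q:] * ([:0, 1:] * [:0, 1:])" by (simp add: Geq)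
  also have "\<dots> \<simeq> [:c, p:] + [:q:] * [:f:]" by (intro eqc_add eqc_mult eqc_refl y_squared)
  finally have "pCons c F \<simeq> [:c + f * q, p:]" by simp
  then show ?case by (intro bexI) auto
qed

lemma reduced_eqc_0:
  assumes "F \<in> coord_funs" "F \<simeq> 0" shows "F = 0"
proof (rule ccontr)
  assume "F \<noteq> 0"
  obtain H where H: "F = [:- f, 0, 1:] * H" using assms(2) by (auto simp: eq_on_curve_def)
  then have "degree F = 2 + degree H" using \<open>F \<noteq> 0\<close> by (subst H, subst degree_mult_eq) auto
  then show False using assms(1) by (simp add: coord_funs_def)
qed

lemma reduced_eqc_eq:
  assumes "F \<in> coord_funs" "G \<in> coord_funs" "F \<simeq> G" shows "F = G"
proof -
  have "F - G \<in> coord_funs" using assms(1,2) by (auto simp: coord_funs_def intro: degree_diff_le)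
  then show ?thesis using reduced_eqc_0[of "F - G"] assms(3) eqc_iff_diff by auto
qed

definition conjugate :: "'a poly poly \<Rightarrow> 'a poly poly" where
  "conjugate F = [:coeff F 0, - coeff F 1:]"

text \<open>
The norm from \<open>K(C)\<close> to \<open>K(x)\<close> of a reduced function.
\<close>

definition norm_poly :: "'a poly poly \<Rightarrow> 'a poly" where
  "norm_poly F = (coeff F 0)\<^sup>2 - (coeff F 1)\<^sup>2 * f"

lemma mult_conjugate: assumes "F \<in> coord_funs" shows "F * conjugate F \<simeq> [:norm_poly F:]"
proof -
  define p q where "p = coeff F 0" and "q = coeff F 1"
  have F: "F = [:p, q:]" using reduced_eq_pair[OF assms] by (simp add: p_def q_def)
  have "F * conjugate F = [:p * p:] - [:q * q:] * ([:0, 1:] * [:0, 1:])"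
    by (simp add: F conjugate_def algebra_simps)
  also have "\<dots> \<simeq> [:p * p:] - [:q * q:] * [:f:]" by (intro eqc_diff eqc_mult eqc_refl y_squared)
  also have "\<dots> = [:norm_poly F:]" by (simp add: F norm_poly_def power2_eq_square)
  finally show ?thesis .
qed

lemma f_neq_0: "f \<noteq> 0" using odd_degree by auto

text \<open>
In \<open>p\<^sup>2 - q\<^sup>2 f\<close> the two terms have degrees of different parity, so nothing cancels. This makes
the norm a substitute for the valuation at infinity: its degree is the pole order there, and it is
visibly multiplicative.
\<close>

lemma degree_norm_poly:
  assumes "F \<in> coord_funs" "F \<noteq> 0"
  shows "norm_poly F \<noteq> 0" "int (degree (norm_poly F)) = - ord_at f Infty F"
proof -
  define p q where "p = coeff F 0" and "q = coeff F 1"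
  have F: "F = [:p, q:]" using reduced_eq_pair[OF assms(1)] by (simp add: p_def q_def)
  have N: "norm_poly F = p\<^sup>2 - q\<^sup>2 * f" by (simp add: norm_poly_def F)
  have "norm_poly F \<noteq> 0 \<and> int (degree (norm_poly F)) = - ord_at f Infty F"
  proof (cases "q = 0")
    case True
    then have "norm_poly F = p\<^sup>2" by (simp add: N)
    then show ?thesis using assms(2) True by (simp add: F degree_power_eq)
  next
    case False
    have dp: "degree (p\<^sup>2) = 2 * degree p" by (cases "p = 0") (simp_all add: degree_power_eq)
    have dq: "degree (q\<^sup>2 * f) = 2 * degree q + degree f" using False f_neq_0
      by (simp add: degree_mult_eq degree_power_eq)
    have "degree (p\<^sup>2) \<noteq> degree (q\<^sup>2 * f)" unfolding dp dq using odd_degree by presburger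
    then consider "degree (p\<^sup>2) < degree (q\<^sup>2 * f)" | "degree (q\<^sup>2 * f) < degree (p\<^sup>2)" by linarith
    then have d: "degree (norm_poly F) = max (2 * degree p) (2 * degree q + degree f)"
    proof cases
      case 1
      then have "degree (norm_poly F) = degree (q\<^sup>2 * f)" unfolding N
        using degree_add_eq_right[of "p\<^sup>2" "- (q\<^sup>2 * f)"] by simp
      then show ?thesis using 1 dp dq by simp
    next
      case 2
      then have "degree (norm_poly F) = degree (p\<^sup>2)" unfolding N
        using degree_add_eq_left[of "- (q\<^sup>2 * f)" "p\<^sup>2"] by simp
      then show ?thesis using 2 dp dq by simp
    qed
    moreover have "degree (norm_poly F) > 0" unfolding d using odd_degree by (auto simp: max_def intro: Nat.gr0I)
    ultimately show ?thesis using False by (auto simp: F)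
  qed
  then show "norm_poly F \<noteq> 0" "int (degree (norm_poly F)) = - ord_at f Infty F" by auto
qed

lemma const_eqc_0: "[:p:] \<simeq> 0 \<longleftrightarrow> p = 0"
  using reduced_eqc_0[of "[:p:]"] by auto

text \<open>
The coordinate ring is a domain: multiplying \<open>F * G\<close> by the conjugate of \<open>F\<close> reduces the claim
to the case that \<open>F\<close> is a nonzero polynomial in \<open>x\<close>.
\<close>

lemma eqc_mult_0:
  assumes "F * G \<simeq> 0" shows "F \<simeq> 0 \<or> G \<simeq> 0"
proof (rule ccontr)
  assume contr: "\<not> ?thesis"
  obtain F' where F': "F' \<in> coord_funs" "F \<simeq> F'" using reduced_exists by blast
  obtain G' where G': "G' \<in> coord_funs" "G \<simeq> G'" using reduced_exists by blast
  have F0: "F' \<noteq> 0" and G0: "G' \<noteq> 0" using contr F' G' by auto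
  define n where "n = norm_poly F'"
  have n: "n \<noteq> 0" using degree_norm_poly(1)[OF F'(1) F0] by (simp add: n_def)
  have "[:n:] * G' \<simeq> (F' * conjugate F') * G'" unfolding n_def
    by (intro eqc_mult eqc_refl eqc_sym[OF mult_conjugate] F')
  also have "\<dots> = conjugate F' * (F' * G')" by (simp only: ac_simps)
  also have "\<dots> \<simeq> conjugate F' * (F * G)" by (intro eqc_mult eqc_refl eqc_sym[OF F'(2)] eqc_sym[OF G'(2)])
  also have "\<dots> \<simeq> conjugate F' * 0" by (intro eqc_mult eqc_refl assms)
  finally have "[:n:] * G' \<simeq> 0" by simp
  moreover have "[:n:] * G' \<in> coord_funs" using G'(1)
    by (auto simp: coord_funs_def)
  ultimately have "[:n:] * G' = 0" using reduced_eqc_0 by blast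
  then show False using n G0 by simp
qed

lemma eqc_cancel:
  assumes "F * G \<simeq> F * H" "\<not> F \<simeq> 0" shows "G \<simeq> H"
proof -
  have "F * (G - H) \<simeq> 0" using assms(1) eqc_iff_diff[of "F * G"] by (simp add: right_diff_distrib)
  then show ?thesis using eqc_mult_0 assms(2) eqc_iff_diff by blast
qed

lemma eval2_neq_0_imp: "b\<^sup>2 = poly f a \<Longrightarrow> eval2 F a b \<noteq> 0 \<Longrightarrow> \<not> F \<simeq> 0"
  using eqc_eval2[of F 0 b a] by auto

lemma norm_poly_mult:
  assumes "F * G \<simeq> H" "F \<in> coord_funs" "G \<in> coord_funs" "H \<in> coord_funs"
  shows "norm_poly F * norm_poly G = norm_poly H"
proof -
  define p q r s where "p = coeff F 0" and "q = coeff F 1" and "r = coeff G 0" and "s = coeff G 1"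
  have F: "F = [:p, q:]" using reduced_eq_pair[OF assms(2)] by (simp add: p_def q_def)
  have G: "G = [:r, s:]" using reduced_eq_pair[OF assms(3)] by (simp add: r_def s_def)
  have "F * G = [:p * r, p * s + q * r:] + [:q * s:] * ([:0, 1:] * [:0, 1:])"
    by (simp add: F G algebra_simps)
  also have "\<dots> \<simeq> [:p * r, p * s + q * r:] + [:q * s:] * [:f:]"
    by (intro eqc_add eqc_mult eqc_refl y_squared)
  finally have "F * G \<simeq> [:p * r + f * (q * s), p * s + q * r:]" by simp
  then have "H \<simeq> [:p * r + f * (q * s), p * s + q * r:]"
    by (rule eqc_trans[OF eqc_sym[OF assms(1)]])
  then have "H = [:p * r + f * (q * s), p * s + q * r:]"
    by (intro reduced_eqc_eq assms pair_in_coord_funs)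
  then show ?thesis by (simp add: F G norm_poly_def power2_eq_square algebra_simps)
qed

end

section \<open>Orders of vanishing\<close>

context odd_curve
begin

abbreviation on_curve :: "'a \<Rightarrow> 'a \<Rightarrow> bool" where "on_curve a b \<equiv> b\<^sup>2 = poly f a"

text \<open>
The relation inside the definite description of \<open>ord_at\<close>.
\<close>

definition has_ord :: "'a \<Rightarrow> 'a \<Rightarrow> 'a poly poly \<Rightarrow> nat \<Rightarrow> bool" where
  "has_ord a b F n \<longleftrightarrow> (\<exists>u v. eval2 u a b \<noteq> 0 \<and> eval2 v a b \<noteq> 0 \<and> v * F \<simeq> uniformizer a b ^ n * u)"

lemma has_ordI: "eval2 u a b \<noteq> 0 \<Longrightarrow> eval2 v a b \<noteq> 0 \<Longrightarrow> v * F \<simeq> uniformizer a b ^ n * u \<Longrightarrow> has_ord a b F n"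
  unfolding has_ord_def by blast

lemma uniformizer_not_0: "\<not> uniformizer a b \<simeq> 0"
proof (cases "b = 0")
  case True
  then show ?thesis using reduced_eqc_0[of "[:0, 1:]"] by (auto simp: uniformizer_def)
next
  case False
  then show ?thesis by (simp add: uniformizer_def const_eqc_0)
qed

lemma power_not_0: "\<not> F \<simeq> 0 \<Longrightarrow> \<not> F ^ n \<simeq> 0"
proof (induction n)
  case 0
  then show ?case using const_eqc_0[of 1] by (simp add: one_pCons)
next
  case (Suc n)
  then show ?case using eqc_mult_0[of F "F ^ n"] by auto
qed

lemma eval2_uniformizer [simp]: "eval2 (uniformizer a b) a b = 0"
  by (simp add: uniformizer_def)

lemma has_ord_unique_aux:
  assumes "on_curve a b" "has_ord a b F m" "has_ord a b F n"
  shows "\<not> m < n"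
proof
  assume "m < n"
  let ?t = "uniformizer a b"
  obtain u v where uv: "eval2 u a b \<noteq> 0" "eval2 v a b \<noteq> 0" "v * F \<simeq> ?t ^ m * u"
    using assms(2) unfolding has_ord_def by blast
  obtain u' v' where uv': "eval2 u' a b \<noteq> 0" "eval2 v' a b \<noteq> 0" "v' * F \<simeq> ?t ^ n * u'"
    using assms(3) unfolding has_ord_def by blast
  have n: "?t ^ n = ?t ^ m * ?t ^ (n - m)" using \<open>m < n\<close> by (simp add: power_add[symmetric])
  have "?t ^ m * (v' * u) = v' * (?t ^ m * u)" by (simp only: ac_simps)
  also have "\<dots> \<simeq> v' * (v * F)" by (intro eqc_mult eqc_refl eqc_sym[OF uv(3)])
  also have "\<dots> = v * (v' * F)" by (simp only: ac_simps)
  also have "\<dots> \<simeq> v * (?t ^ n * u')" by (intro eqc_mult eqc_refl uv')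
  also have "\<dots> = ?t ^ m * (v * (?t ^ (n - m) * u'))"
    unfolding n by (simp only: ac_simps)
  finally have "v' * u \<simeq> v * (?t ^ (n - m) * u')"
    by (rule eqc_cancel) (rule power_not_0[OF uniformizer_not_0])
  from eqc_eval2[OF this assms(1)] have "eval2 v' a b * eval2 u a b = 0"
    using \<open>m < n\<close> by (simp add: power_0_left)
  then show False using uv uv' by simp
qed

lemma has_ord_unique:
  "on_curve a b \<Longrightarrow> has_ord a b F m \<Longrightarrow> has_ord a b F n \<Longrightarrow> m = n"
  using has_ord_unique_aux[of b a F m n] has_ord_unique_aux[of b a F n m] by linarith

lemma has_ord_cong: "F \<simeq> G \<Longrightarrow> has_ord a b F n \<Longrightarrow> has_ord a b G n"
  unfolding has_ord_def using eqc_mult[OF eqc_refl eqc_sym] eqc_trans by blast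

lemma has_ord_mult:
  assumes "has_ord a b F m" "has_ord a b G n"
  shows "has_ord a b (F * G) (m + n)"
proof -
  let ?t = "uniformizer a b"
  obtain u v where uv: "eval2 u a b \<noteq> 0" "eval2 v a b \<noteq> 0" "v * F \<simeq> ?t ^ m * u"
    using assms(1) unfolding has_ord_def by blast
  obtain u' v' where uv': "eval2 u' a b \<noteq> 0" "eval2 v' a b \<noteq> 0" "v' * G \<simeq> ?t ^ n * u'"
    using assms(2) unfolding has_ord_def by blast
  have "(v * v') * (F * G) = (v * F) * (v' * G)" by (simp only: ac_simps)
  also have "\<dots> \<simeq> (?t ^ m * u) * (?t ^ n * u')" by (intro eqc_mult uv uv')
  also have "\<dots> = ?t ^ (m + n) * (u * u')" by (simp only: ac_simps power_add)
  finally show ?thesis using uv uv' by (intro has_ordI) auto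
qed

lemma has_ord_0: "eval2 F a b \<noteq> 0 \<Longrightarrow> has_ord a b F 0"
  by (rule has_ordI[of F _ _ 1]) auto

lemma has_ord_uniformizer: "has_ord a b (uniformizer a b) 1"
  by (rule has_ordI[of 1 _ _ 1]) auto

lemma has_ord_divide_unit:
  assumes "eval2 w a b \<noteq> 0" "has_ord a b (w * F) n" shows "has_ord a b F n"
proof -
  obtain u v where uv: "eval2 u a b \<noteq> 0" "eval2 v a b \<noteq> 0" "v * (w * F) \<simeq> uniformizer a b ^ n * u"
    using assms(2) unfolding has_ord_def by blast
  then show ?thesis using assms(1) by (intro has_ordI[of u _ _ "v * w"]) (auto simp: mult.assoc)
qed

lemma has_ord_add_less:
  assumes "has_ord a b F m" "has_ord a b G n" "m < n"
  shows "has_ord a b (F + G) m"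
proof -
  let ?t = "uniformizer a b"
  obtain u v where uv: "eval2 u a b \<noteq> 0" "eval2 v a b \<noteq> 0" "v * F \<simeq> ?t ^ m * u"
    using assms(1) unfolding has_ord_def by blast
  obtain u' v' where uv': "eval2 u' a b \<noteq> 0" "eval2 v' a b \<noteq> 0" "v' * G \<simeq> ?t ^ n * u'"
    using assms(2) unfolding has_ord_def by blast
  have n: "?t ^ n = ?t ^ m * ?t ^ (n - m)" using assms(3) by (simp add: power_add[symmetric])
  have "(v * v') * (F + G) = v' * (v * F) + v * (v' * G)" by (simp add: algebra_simps)
  also have "\<dots> \<simeq> v' * (?t ^ m * u) + v * (?t ^ n * u')" by (intro eqc_add eqc_mult eqc_refl uv uv')
  also have "\<dots> = ?t ^ m * (v' * u + v * (?t ^ (n - m) * u'))" unfolding n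
    by (simp add: algebra_simps)
  finally show ?thesis using uv uv' assms(3) by (intro has_ordI) (auto simp: power_0_left)
qed

lemma f_at_branch_point:
  assumes "poly f a = 0"
  obtains f1 where "f = [:- a, 1:] * f1" "poly f1 a \<noteq> 0"
proof -
  have "order a f = 1" using rsquarefree_root_order[OF squarefree assms f_neq_0] .
  with order_decomp[OF f_neq_0, of a] obtain q where "f = [:- a, 1:] * q" "\<not> [:- a, 1:] dvd q" by auto
  then show ?thesis using that by (simp add: poly_eq_0_iff_dvd)
qed

text \<open>
At a branch point \<open>x - a\<close> is \<open>y\<^sup>2\<close> up to a unit, since \<open>f\<close> has a simple root there.
\<close>

lemma has_ord_const:
  assumes "on_curve a b" "p \<noteq> 0"
  shows "has_ord a b [:p:] (if b = 0 then 2 * order a p else order a p)"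
proof -
  define n where "n = order a p"
  obtain p1 where p1: "p = [:- a, 1:] ^ n * p1" "poly p1 a \<noteq> 0"
    using order_decomp[OF assms(2), of a] unfolding n_def by (auto simp: poly_eq_0_iff_dvd)
  show ?thesis
  proof (cases "b = 0")
    case False
    have "[:p:] = uniformizer a b ^ n * [:p1:]"
      using False by (simp add: uniformizer_def poly_const_pow p1(1))
    then have "has_ord a b [:p:] n" using p1(2) by (intro has_ordI[of "[:p1:]" _ _ 1]) auto
    then show ?thesis using False by (simp add: n_def)
  next
    case True
    then have "poly f a = 0" using assms(1) by simp
    then obtain f1 where f1: "f = [:- a, 1:] * f1" "poly f1 a \<noteq> 0" by (rule f_at_branch_point)
    have e: "f1 ^ n * p = f ^ n * p1" unfolding p1(1) f1(1) power_mult_distrib by (simp only: ac_simps)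
    have "[:f1 ^ n:] * [:p:] = [:f1 ^ n * p:]" by simp
    also have "\<dots> = [:f:] ^ n * [:p1:]" unfolding e by (simp add: poly_const_pow)
    also have "\<dots> \<simeq> ([:0, 1:] * [:0, 1:]) ^ n * [:p1:]"
      by (intro eqc_mult eqc_power eqc_refl eqc_sym[OF y_squared])
    also have "\<dots> = uniformizer a b ^ (2 * n) * [:p1:]"
      using True by (simp only: uniformizer_def power_mult power2_eq_square if_True refl)
    finally have "has_ord a b [:p:] (2 * n)" using p1(2) f1(2)
      by (intro has_ordI[of "[:p1:]" _ _ "[:f1 ^ n:]"]) auto
    then show ?thesis using True by (simp add: n_def)
  qed
qed

text \<open>
If \<open>F\<close> or its conjugate does not vanish at the point, the order of \<open>F\<close> is 0 or that of the norm.
If both vanish, then so do \<open>p\<close> and \<open>q\<close>, because \<open>2 b \<noteq> 0\<close>; a factor \<open>x - a\<close> splits off, and the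
degree of the norm drops.
\<close>

lemma has_ord_exists_unramified:
  assumes "on_curve a b" "b \<noteq> 0" "F \<in> coord_funs" "F \<noteq> 0"
  shows "\<exists>n. has_ord a b F n"
  using assms(3,4)
proof (induction "degree (norm_poly F)" arbitrary: F rule: less_induct)
  case less
  define p q where "p = coeff F 0" and "q = coeff F 1"
  have F: "F = [:p, q:]" using reduced_eq_pair[OF less(2)] by (simp add: p_def q_def)
  consider "eval2 F a b \<noteq> 0" | "eval2 (conjugate F) a b \<noteq> 0"
    | "eval2 F a b = 0" "eval2 (conjugate F) a b = 0" by blast
  then show ?case
  proof cases
    case 1
    then show ?thesis using has_ord_0 by blast
  next
    case 2
    have "has_ord a b [:norm_poly F:] (order a (norm_poly F))"
      using has_ord_const[OF assms(1) degree_norm_poly(1)[OF less(2,3)]] assms(2) by simp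
    then have "has_ord a b (conjugate F * F) (order a (norm_poly F))"
      using has_ord_cong[OF eqc_sym[OF mult_conjugate[OF less(2)]]] by (simp add: mult.commute)
    then show ?thesis using has_ord_divide_unit[OF 2] by blast
  next
    case 3
    then have e: "poly p a + b * poly q a = 0" "poly p a - b * poly q a = 0"
      by (auto simp: F conjugate_def)
    then have "2 * poly p a = 0" by (simp add: algebra_simps)
    then have pa: "poly p a = 0" using two_neq_0 by simp
    then have qa: "poly q a = 0" using e assms(2) by simp
    obtain p' q' where pq: "p = [:- a, 1:] * p'" "q = [:- a, 1:] * q'"
      using pa qa unfolding poly_eq_0_iff_dvd by (auto elim!: dvdE)
    define F' where "F' = [:p', q':]"
    have F': "F = uniformizer a b * F'" using assms(2) by (simp add: F F'_def pq uniformizer_def)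
    have "F' \<noteq> 0" using less(3) F' by auto
    have "norm_poly F = [:- a, 1:] ^ 2 * norm_poly F'"
      unfolding norm_poly_def F F'_def pq by (simp add: power_mult_distrib right_diff_distrib mult.assoc del: mult_pCons_left)
    moreover have "norm_poly F' \<noteq> 0" using degree_norm_poly(1)[of F'] \<open>F' \<noteq> 0\<close> by (simp add: F'_def)
    ultimately have "degree (norm_poly F') < degree (norm_poly F)"
      by (simp add: degree_mult_eq degree_power_eq)
    then obtain n where "has_ord a b F' n" using less(1)[of F'] \<open>F' \<noteq> 0\<close> by (auto simp: F'_def)
    then show ?thesis using has_ord_mult[OF has_ord_uniformizer] F' by metis
  qed
qed

text \<open>
At a branch point \<open>p\<close> has even and \<open>q y\<close> has odd order, so the smaller one is the order of the sum.
\<close>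

lemma has_ord_exists:
  assumes "on_curve a b" "\<not> F \<simeq> 0"
  shows "\<exists>n. has_ord a b F n"
proof -
  obtain G where G: "G \<in> coord_funs" "F \<simeq> G" using reduced_exists by blast
  have G0: "G \<noteq> 0" using assms(2) G by auto
  have "\<exists>n. has_ord a b G n"
  proof (cases "b = 0")
    case False
    then show ?thesis using has_ord_exists_unramified assms(1) G G0 by blast
  next
    case True
    define p q where "p = coeff G 0" and "q = coeff G 1"
    have Geq: "G = [:p:] + [:0, 1:] * [:q:]" using reduced_eq_pair[OF G(1)] by (simp add: p_def q_def)
    have P: "has_ord a b [:p:] (2 * order a p)" if "p \<noteq> 0"
      using has_ord_const[OF assms(1) that] True by simp
    have Q: "has_ord a b ([:0, 1:] * [:q:]) (1 + 2 * order a q)" if "q \<noteq> 0"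
      using has_ord_mult[OF has_ord_uniformizer has_ord_const[OF assms(1) that]] True
      by (simp add: uniformizer_def)
    consider "p = 0" | "q = 0" | "p \<noteq> 0" "q \<noteq> 0" by blast
    then show ?thesis
    proof cases
      case 1
      then show ?thesis using Geq Q G0 by (cases "q = 0") auto
    next
      case 2
      then show ?thesis using Geq P G0 by (cases "p = 0") auto
    next
      case 3
      have "2 * order a p < 1 + 2 * order a q \<or> 1 + 2 * order a q < 2 * order a p" by arith
      then consider "2 * order a p < 1 + 2 * order a q" | "1 + 2 * order a q < 2 * order a p" by blast
      then show ?thesis
        using has_ord_add_less[OF P[OF 3(1)] Q[OF 3(2)]] has_ord_add_less[OF Q[OF 3(2)] P[OF 3(1)]]
        unfolding Geq by cases (auto simp: add.commute)
    qed
  qed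
  then show ?thesis using has_ord_cong[OF eqc_sym[OF G(2)]] by blast
qed

abbreviation ord :: "'a \<Rightarrow> 'a \<Rightarrow> 'a poly poly \<Rightarrow> int" where "ord a b F \<equiv> ord_at f (Aff a b) F"

lemma ord_eqI:
  assumes "on_curve a b" "has_ord a b F n" shows "ord a b F = int n"
proof -
  have "(THE n. has_ord a b F n) = n" using assms has_ord_unique by blast
  then show ?thesis by (simp add: has_ord_def)
qed

lemma ord_cases:
  assumes "on_curve a b" "\<not> F \<simeq> 0"
  obtains n where "has_ord a b F n" "ord a b F = int n"
  using has_ord_exists[OF assms] ord_eqI[OF assms(1)] by blast

lemma ord_mult:
  assumes "on_curve a b" "\<not> F \<simeq> 0" "\<not> G \<simeq> 0"
  shows "ord a b (F * G) = ord a b F + ord a b G"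
proof -
  obtain m where m: "has_ord a b F m" "ord a b F = int m" using ord_cases assms(1,2) .
  obtain n where n: "has_ord a b G n" "ord a b G = int n" using ord_cases assms(1,3) .
  show ?thesis using ord_eqI[OF assms(1) has_ord_mult[OF m(1) n(1)]] m n by simp
qed

lemma ord_cong:
  assumes "on_curve a b" "\<not> F \<simeq> 0" "F \<simeq> G"
  shows "ord a b F = ord a b G"
proof -
  obtain m where m: "has_ord a b F m" "ord a b F = int m" using ord_cases assms(1,2) .
  show ?thesis using ord_eqI[OF assms(1) has_ord_cong[OF assms(3) m(1)]] m(2) by simp
qed

lemma ord_nonneg [simp]: "ord a b F \<ge> 0" by simp

lemma ord_unit: "on_curve a b \<Longrightarrow> eval2 F a b \<noteq> 0 \<Longrightarrow> ord a b F = 0"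
  using ord_eqI[OF _ has_ord_0] by simp

lemma ord_pos:
  assumes "on_curve a b" "\<not> F \<simeq> 0" "eval2 F a b = 0"
  shows "ord a b F \<ge> 1"
proof -
  obtain n where n: "has_ord a b F n" "ord a b F = int n" using ord_cases assms(1,2) .
  have "n \<noteq> 0"
  proof
    assume "n = 0"
    then obtain u v where uv: "eval2 u a b \<noteq> 0" "v * F \<simeq> u"
      using n(1) unfolding has_ord_def by auto
    then show False using eqc_eval2[OF uv(2) assms(1)] assms(3) by simp
  qed
  then show ?thesis using n(2) by simp
qed

lemma ord_const:
  "on_curve a b \<Longrightarrow> p \<noteq> 0 \<Longrightarrow> ord a b [:p:] = (if b = 0 then 2 * int (order a p) else int (order a p))"
  using ord_eqI[OF _ has_ord_const] by simp

lemma ord_power: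
  assumes "on_curve a b" "\<not> F \<simeq> 0"
  shows "ord a b (F ^ n) = int n * ord a b F"
proof (induction n)
  case 0
  then show ?case using ord_unit[OF assms(1), of 1] by simp
next
  case (Suc n)
  then show ?case using ord_mult[OF assms power_not_0[OF assms(2)]] by (simp add: algebra_simps)
qed

section \<open>Divisibility in the local rings and on the whole curve\<close>

text \<open>
Divisibility in the local ring of the point. Unlike an inequality of orders it makes sense
for functions that may be zero, and it is an equation that a linear map can act on.
\<close>

definition loc_dvd :: "'a \<Rightarrow> 'a \<Rightarrow> 'a poly poly \<Rightarrow> 'a poly poly \<Rightarrow> bool" where
  "loc_dvd a b G F \<longleftrightarrow> (\<exists>u v. eval2 v a b \<noteq> 0 \<and> v * F \<simeq> G * u)"

lemma loc_dvd_iff: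
  assumes on: "on_curve a b" and F: "\<not> F \<simeq> 0" and G: "\<not> G \<simeq> 0"
  shows "loc_dvd a b G F \<longleftrightarrow> ord a b G \<le> ord a b F"
proof
  assume "loc_dvd a b G F"
  then obtain u v where uv: "eval2 v a b \<noteq> 0" "v * F \<simeq> G * u" unfolding loc_dvd_def by blast
  have v: "\<not> v \<simeq> 0" using eval2_neq_0_imp on uv(1) by blast
  have vF: "\<not> v * F \<simeq> 0" using eqc_mult_0 v F by blast
  have u: "\<not> u \<simeq> 0"
  proof
    assume "u \<simeq> 0"
    then have "G * u \<simeq> G * 0" by (intro eqc_mult eqc_refl)
    then show False using vF uv(2) eqc_trans by (metis mult_zero_right)
  qed
  have "ord a b v + ord a b F = ord a b (v * F)" by (simp only: ord_mult[OF on v F])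
  also have "\<dots> = ord a b (G * u)" by (rule ord_cong[OF on vF uv(2)])
  also have "\<dots> = ord a b G + ord a b u" by (rule ord_mult[OF on G u])
  finally show "ord a b G \<le> ord a b F"
    using ord_unit[OF on uv(1)] ord_nonneg[of a b u] by linarith
next
  assume le: "ord a b G \<le> ord a b F"
  let ?t = "uniformizer a b"
  obtain m where m: "has_ord a b F m" "ord a b F = int m" using ord_cases on F .
  obtain n where n: "has_ord a b G n" "ord a b G = int n" using ord_cases on G .
  have "n \<le> m" using le m n by linarith
  obtain u v where uv: "eval2 u a b \<noteq> 0" "eval2 v a b \<noteq> 0" "v * F \<simeq> ?t ^ m * u"
    using m(1) unfolding has_ord_def by blast
  obtain u' v' where uv': "eval2 u' a b \<noteq> 0" "eval2 v' a b \<noteq> 0" "v' * G \<simeq> ?t ^ n * u'"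
    using n(1) unfolding has_ord_def by blast
  have t: "?t ^ m = ?t ^ n * ?t ^ (m - n)" using \<open>n \<le> m\<close> by (simp add: power_add[symmetric])
  have "(u' * v) * F = u' * (v * F)" by (simp only: ac_simps)
  also have "\<dots> \<simeq> u' * (?t ^ m * u)" by (intro eqc_mult eqc_refl uv)
  also have "\<dots> = (?t ^ n * u') * (?t ^ (m - n) * u)" unfolding t by (simp only: ac_simps)
  also have "\<dots> \<simeq> (v' * G) * (?t ^ (m - n) * u)" by (intro eqc_mult eqc_refl eqc_sym[OF uv'(3)])
  also have "\<dots> = G * (v' * ?t ^ (m - n) * u)" by (simp only: ac_simps)
  finally show "loc_dvd a b G F" unfolding loc_dvd_def using uv uv'
    by (intro exI[of _ "v' * ?t ^ (m - n) * u"] exI[of _ "u' * v"]) auto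
qed

lemma loc_dvd_mult:
  assumes "loc_dvd a b G F" shows "loc_dvd a b (G * W) (F * W)" "loc_dvd a b G (F * W)"
proof -
  obtain u v where uv: "eval2 v a b \<noteq> 0" "v * F \<simeq> G * u" using assms unfolding loc_dvd_def by blast
  have *: "v * (F * W) \<simeq> (G * u) * W" using eqc_mult[OF uv(2) eqc_refl[of W]] by (simp add: mult.assoc)
  then show "loc_dvd a b G (F * W)" unfolding loc_dvd_def using uv(1) by (auto simp: mult.assoc)
  from * show "loc_dvd a b (G * W) (F * W)" unfolding loc_dvd_def using uv(1)
    by (intro exI[of _ u] exI[of _ v]) (auto simp: ac_simps)
qed

lemma loc_dvd_cong:
  assumes "G \<simeq> G'" "F \<simeq> F'" "loc_dvd a b G F" shows "loc_dvd a b G' F'"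
proof -
  obtain u v where uv: "eval2 v a b \<noteq> 0" "v * F \<simeq> G * u" using assms(3) unfolding loc_dvd_def by blast
  have "v * F' \<simeq> v * F" by (intro eqc_mult eqc_refl eqc_sym[OF assms(2)])
  also note uv(2)
  also have "G * u \<simeq> G' * u" by (intro eqc_mult eqc_refl assms)
  finally show ?thesis using uv(1) unfolding loc_dvd_def by blast
qed

lemma loc_dvd_0: "F \<simeq> 0 \<Longrightarrow> loc_dvd a b G F"
  unfolding loc_dvd_def by (intro exI[of _ 0] exI[of _ 1]) auto

lemma loc_dvd_left: "loc_dvd a b (G * W) F \<Longrightarrow> loc_dvd a b G F"
  unfolding loc_dvd_def by (auto simp: mult.assoc)

lemma loc_dvd_cancel:
  assumes "\<not> W \<simeq> 0" "loc_dvd a b (W * G) (W * F)" shows "loc_dvd a b G F"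
proof -
  obtain u v where uv: "eval2 v a b \<noteq> 0" "v * (W * F) \<simeq> W * G * u"
    using assms(2) unfolding loc_dvd_def by blast
  have "W * (v * F) \<simeq> W * (G * u)" using uv(2) by (simp only: ac_simps)
  then have "v * F \<simeq> G * u" using eqc_cancel assms(1) by blast
  then show ?thesis using uv(1) unfolding loc_dvd_def by blast
qed

lemma loc_dvd_eval2:
  assumes "on_curve a b" "loc_dvd a b G F" "eval2 G a b = 0" shows "eval2 F a b = 0"
proof -
  obtain u v where uv: "eval2 v a b \<noteq> 0" "v * F \<simeq> G * u" using assms(2) unfolding loc_dvd_def by blast
  show ?thesis using eqc_eval2[OF uv(2) assms(1)] uv(1) assms(3) by simp
qed

text \<open>
Over an unramified \<open>c\<close> there are two points, and vanishing at both kills \<open>p\<close> and \<open>q\<close> at \<open>c\<close>. Over a branch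
point there is one, but \<open>x - c\<close> has order 2 there; once \<open>x - c\<close> divides \<open>p\<close>, the order of \<open>q y\<close>
is at least 2 as well, so that \<open>q\<close> vanishes at \<open>c\<close>.
\<close>

lemma dvd_of_loc_dvd_linear:
  assumes loc: "\<And>b. on_curve c b \<Longrightarrow> loc_dvd c b [:[:- c, 1:]:] S"
  shows "\<exists>T. S \<simeq> [:[:- c, 1:]:] * T"
proof -
  obtain S' where S': "S' \<in> coord_funs" "S \<simeq> S'" using reduced_exists by blast
  define p q where "p = coeff S' 0" and "q = coeff S' 1"
  have Seq: "S' = [:p, q:]" using reduced_eq_pair[OF S'(1)] by (simp add: p_def q_def)
  have loc': "loc_dvd c b [:[:- c, 1:]:] S'" if "on_curve c b" for b
    using loc_dvd_cong[OF eqc_refl S'(2) loc[OF that]] .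
  obtain b where b: "on_curve c b" using nth_root_exists[of 2 "poly f c"] by auto
  have ev: "poly p c + b * poly q c = 0" if "on_curve c b" for b
    using loc_dvd_eval2[OF that loc'[OF that]] by (simp add: Seq)
  have "poly p c = 0 \<and> poly q c = 0"
  proof (cases "b = 0")
    case False
    have e: "poly p c + b * poly q c = 0" "poly p c - b * poly q c = 0"
      using ev[of b] ev[of "- b"] b by simp_all
    then have "2 * poly p c = 0" by (simp add: algebra_simps)
    then have "poly p c = 0" using two_neq_0 by simp
    then show ?thesis using e False by simp
  next
    case True
    then have pc: "poly p c = 0" using ev[OF b] by simp
    then obtain p' where p': "p = [:- c, 1:] * p'" unfolding poly_eq_0_iff_dvd by (auto elim!: dvdE)
    have "poly f c = 0" using b True by simp
    then obtain f1 where f1: "f = [:- c, 1:] * f1" "poly f1 c \<noteq> 0" by (rule f_at_branch_point)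
    obtain u v where uv: "eval2 v c b \<noteq> 0" "v * S' \<simeq> [:[:- c, 1:]:] * u"
      using loc'[OF b] unfolding loc_dvd_def by blast
    let ?y = "[:0, 1:] :: 'a poly poly" and ?x = "[:[:- c, 1:]:] :: 'a poly poly"
    have Y: "?y * [:q:] = S' - ?x * [:p':]" by (simp add: Seq p')
    have "?y * (v * [:f1:] * [:q:]) = [:f1:] * (v * (?y * [:q:]))" by (simp only: ac_simps)
    also have "\<dots> = [:f1:] * (v * S' - ?x * (v * [:p':]))"
      unfolding Y by (simp only: right_diff_distrib mult.left_commute)
    also have "\<dots> \<simeq> [:f1:] * (?x * u - ?x * (v * [:p':]))"
      by (intro eqc_mult eqc_diff eqc_refl uv)
    also have "\<dots> = ([:f1:] * ?x) * (u - v * [:p':])"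
      by (simp only: right_diff_distrib mult.assoc)
    also have "[:f1:] * ?x = [:f:]" unfolding f1(1) by (simp add: mult.commute)
    also have "[:f:] * (u - v * [:p':]) \<simeq> (?y * ?y) * (u - v * [:p':])"
      by (intro eqc_mult eqc_refl eqc_sym[OF y_squared])
    also have "\<dots> = ?y * (?y * (u - v * [:p':]))" by (simp only: mult.assoc)
    finally have "v * [:f1:] * [:q:] \<simeq> ?y * (u - v * [:p':])"
      by (rule eqc_cancel) (use uniformizer_not_0[of c 0] in \<open>simp add: uniformizer_def\<close>)
    from eqc_eval2[OF this b] have "eval2 v c b * poly f1 c * poly q c = 0"
      using True by (simp only: eval2_simps) simp
    then show ?thesis using pc uv(1) f1(2) by simp
  qed
  then obtain p' q' where pq: "p = [:- c, 1:] * p'" "q = [:- c, 1:] * q'"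
    unfolding poly_eq_0_iff_dvd by (auto elim!: dvdE)
  have "S \<simeq> [:[:- c, 1:]:] * [:p', q':]" using S'(2) by (simp add: Seq pq)
  then show ?thesis by blast
qed

lemma dvd_of_loc_dvd_const:
  assumes "n \<noteq> 0" "\<And>a b. on_curve a b \<Longrightarrow> loc_dvd a b [:n:] S"
  shows "\<exists>T. S \<simeq> [:n:] * T"
  using assms
proof (induction "degree n" arbitrary: n)
  case 0
  then obtain k where k: "n = [:k:]" using degree_eq_zeroE by metis
  then have "S = [:n:] * ([:[:inverse k:]:] * S)" using 0(2) by (simp add: mult.assoc[symmetric] pCons_one)
  then show ?case by (metis eqc_refl)
next
  case (Suc d)
  obtain c where "poly n c = 0" using alg_closed_imp_poly_has_root[of n] Suc(2) by auto
  then obtain m where m: "n = [:- c, 1:] * m" unfolding poly_eq_0_iff_dvd by (auto elim!: dvdE)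
  have m0: "m \<noteq> 0" using m Suc(3) by auto
  have "degree n = Suc (degree m)" using m0 unfolding m by (subst degree_mult_eq) auto
  then have d: "d = degree m" using Suc(2) by simp
  have n: "[:n:] = [:m:] * [:[:- c, 1:]:]" unfolding m by (simp add: mult.commute)
  have loc: "loc_dvd a b [:m:] S" if "on_curve a b" for a b
    using loc_dvd_left Suc(4)[OF that] unfolding n by blast
  from Suc(1)[OF d m0 loc] obtain T1 where T1: "S \<simeq> [:m:] * T1" by blast
  have "loc_dvd c b [:[:- c, 1:]:] T1" if "on_curve c b" for b
    using loc_dvd_cong[OF _ T1 Suc(4)[OF that], of "[:m:] * [:[:- c, 1:]:]"] m0 n
      loc_dvd_cancel[of "[:m:]"] const_eqc_0 eqc_refl by metis
  from dvd_of_loc_dvd_linear[OF this] obtain T where T: "T1 \<simeq> [:[:- c, 1:]:] * T" by blast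
  have "[:m:] * T1 \<simeq> [:m:] * ([:[:- c, 1:]:] * T)" by (intro eqc_mult eqc_refl T)
  also have "\<dots> = [:n:] * T" by (simp only: n mult.assoc)
  finally show ?case using T1 eqc_trans by blast
qed

text \<open>
Divisibility at all points of an affine open set \<open>H \<noteq> 0\<close> is divisibility after inverting \<open>H\<close>. Passing to
the norm \<open>N\<close> of \<open>F\<close> reduces this to a divisor in \<open>K[x]\<close>. At the points where \<open>H\<close> vanishes, a power of
\<open>H\<close> exceeds the order of \<open>N\<close>, which is bounded by twice the degree.
\<close>

lemma dvd_of_loc_dvd:
  assumes F: "\<not> F \<simeq> 0"
    and loc: "\<And>a b. on_curve a b \<Longrightarrow> eval2 H a b \<noteq> 0 \<Longrightarrow> loc_dvd a b F S"
  shows "\<exists>k T. H ^ k * S \<simeq> F * T"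
proof -
  obtain F' where F': "F' \<in> coord_funs" "F \<simeq> F'" using reduced_exists by blast
  have F'0: "F' \<noteq> 0" using F F' by auto
  define N where "N = norm_poly F'"
  have N0: "N \<noteq> 0" using degree_norm_poly(1)[OF F'(1) F'0] by (simp add: N_def)
  have FN: "F' * conjugate F' \<simeq> [:N:]" unfolding N_def by (rule mult_conjugate[OF F'(1)])
  have N_not_0: "\<not> [:N:] \<simeq> 0" using N0 const_eqc_0 by blast
  \<comment> \<open>The successor makes \<open>H ^ k\<close> vanish when \<open>H\<close> does, even if \<open>N\<close> is constant.\<close>
  define k where "k = Suc (2 * degree N)"
  have "loc_dvd a b [:N:] (H ^ k * (S * conjugate F'))" if on: "on_curve a b" for a b
  proof (cases "eval2 H a b = 0")
    case False
    have "loc_dvd a b F' S" using loc_dvd_cong[OF F'(2) eqc_refl loc[OF on False]] .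
    from loc_dvd_mult(1)[OF this, of "conjugate F'"] have "loc_dvd a b [:N:] (S * conjugate F')"
      using loc_dvd_cong[OF FN eqc_refl] by blast
    from loc_dvd_mult(2)[OF this, of "H ^ k"] show ?thesis by (simp add: mult.commute)
  next
    case True
    have "loc_dvd a b [:N:] (H ^ k)"
    proof (cases "H \<simeq> 0")
      case True
      then have "H ^ k \<simeq> 0 ^ k" by (rule eqc_power)
      then show ?thesis by (intro loc_dvd_0) (simp add: k_def)
    next
      case H: False
      have "ord a b [:N:] \<le> 2 * int (degree N)"
        using ord_const[OF on N0] order_degree[OF N0, of a] by auto
      also have "\<dots> \<le> int k * 1" by (simp add: k_def)
      also have "\<dots> \<le> int k * ord a b H" using ord_pos[OF on H True] by (intro mult_left_mono) auto
      finally have "ord a b [:N:] \<le> ord a b (H ^ k)" by (simp only: ord_power[OF on H])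
      then show ?thesis using loc_dvd_iff[OF on power_not_0[OF H] N_not_0] by blast
    qed
    then show ?thesis by (rule loc_dvd_mult(2))
  qed
  from dvd_of_loc_dvd_const[OF N0 this] obtain T where T: "H ^ k * (S * conjugate F') \<simeq> [:N:] * T" by blast
  have "conjugate F' * (H ^ k * S) = H ^ k * (S * conjugate F')" by (simp only: ac_simps)
  also note T
  also have "[:N:] * T \<simeq> (F' * conjugate F') * T" by (intro eqc_mult eqc_refl eqc_sym[OF FN])
  also have "\<dots> = conjugate F' * (F' * T)" by (simp only: ac_simps)
  finally have "H ^ k * S \<simeq> F' * T"
  proof (rule eqc_cancel)
    show "\<not> conjugate F' \<simeq> 0"
    proof
      assume "conjugate F' \<simeq> 0"
      then have "F' * conjugate F' \<simeq> F' * 0" by (intro eqc_mult eqc_refl)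
      then have "[:N:] \<simeq> 0" using eqc_trans[OF eqc_sym[OF FN]] by simp
      then show False using N_not_0 by blast
    qed
  qed
  also have "F' * T \<simeq> F * T" by (intro eqc_mult eqc_refl eqc_sym[OF F'(2)])
  finally show ?thesis by blast
qed

end

section \<open>Mumford pairs and their divisors\<close>

lemma sum_order_eq_degree:
  fixes p :: "'a::alg_closed_field poly"
  assumes "p \<noteq> 0"
  shows "(\<Sum>c | poly p c = 0. order c p) = degree p"
proof -
  obtain A where A: "size A = degree p" "p = smult (lead_coeff p) (\<Prod>x\<in>#A. [:- x, 1:])"
    using alg_closed_imp_factorization[OF assms] by blast
  have *: "(\<Prod>x\<in>#A. [:- x, 1:]) \<noteq> 0 \<and> proots (\<Prod>x\<in>#A. [:- x, 1:]) = A" for A :: "'a multiset"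
    by (induction A) (auto simp: proots_mult simp del: mult_pCons_left)
  have "proots p = A" using arg_cong[OF A(2), of proots] assms * by simp
  then have "size (proots p) = degree p" using A(1) by simp
  then show ?thesis using assms by (simp add: size_multiset_overloaded_eq)
qed

lemma div_degree_eq_sum:
  assumes "finite A" "Poly_Mapping.keys D \<subseteq> A"
  shows "div_degree D = (\<Sum>P\<in>A. Poly_Mapping.lookup D P)"
  unfolding div_degree_def using assms
  by (intro sum.mono_neutral_left) (auto simp: in_keys_iff)

declare ord_at.simps(1) [simp del]

text \<open>
Mumford representations, over the algebraically closed field, of reduced divisors of degree at most
the genus that contain no branch point; the latter is what \<open>V_nonzero\<close> says.
\<close>

locale mumford_pair = odd_curve f for f :: "'a::alg_closed_field poly" +
  fixes U V W :: "'a poly"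
  assumes monic: "lead_coeff U = 1"
    and degree_U: "2 * degree U < degree f"
    and degree_V: "V = 0 \<or> degree V < degree U"
    and f_eq: "f - V\<^sup>2 = U * W"
    and V_nonzero: "poly U c = 0 \<Longrightarrow> poly V c \<noteq> 0"
begin

lemma U_neq_0: "U \<noteq> 0" using monic by auto

lemma finite_roots: "finite {c. poly U c = 0}" using U_neq_0 by (rule poly_roots_finite)

lemma f_at_root: assumes "poly U c = 0" shows "poly f c = (poly V c)\<^sup>2"
proof -
  have "poly (f - V\<^sup>2) c = 0" by (simp only: f_eq poly_mult assms mult_zero_left)
  then show ?thesis by simp
qed

lemma on_curve_root: "poly U c = 0 \<Longrightarrow> on_curve c (poly V c)" "poly U c = 0 \<Longrightarrow> on_curve c (- poly V c)"
  using f_at_root by auto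

lemma root_unramified: "poly U a = 0 \<Longrightarrow> on_curve a b \<Longrightarrow> b \<noteq> 0"
  using f_at_root V_nonzero by auto

lemma point_over_root: "poly U a = 0 \<Longrightarrow> on_curve a b \<Longrightarrow> b = poly V a \<or> b = - poly V a"
  using f_at_root[of a] by (simp add: power2_eq_iff)

lemma ord_U: assumes "on_curve a b" shows "ord a b [:U:] = int (order a U)"
  using ord_const[OF assms U_neq_0] order_0I[of U a] root_unramified[OF _ assms] by (cases "poly U a = 0") auto

definition mdiv :: "'a divisor" where
  "mdiv = (\<Sum>c | poly U c = 0. Poly_Mapping.single (Aff c (poly V c)) (int (order c U)))
     - Poly_Mapping.single Infty (int (degree U))"

lemma mumford_point_eq: "mumford_point f U V = cl f mdiv"
  by (simp add: mumford_point_def mdiv_def)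

lemma lookup_mdiv_Aff:
  "Poly_Mapping.lookup mdiv (Aff a b) = (if poly U a = 0 \<and> b = poly V a then int (order a U) else 0)"
proof -
  have "Poly_Mapping.lookup mdiv (Aff a b) =
    (\<Sum>c | poly U c = 0. if c = a then (if b = poly V a then int (order a U) else 0) else 0)"
    unfolding mdiv_def lookup_minus lookup_sum
    by (auto simp: lookup_single when_def intro!: sum.cong sum.neutral)
  also have "\<dots> = (if poly U a = 0 \<and> b = poly V a then int (order a U) else 0)"
    by (subst sum.delta[OF finite_roots]) auto
  finally show ?thesis .
qed

lemma lookup_mdiv_Infty: "Poly_Mapping.lookup mdiv Infty = - int (degree U)"
  unfolding mdiv_def lookup_minus lookup_sum by (simp add: lookup_single when_def)

lemma keys_mdiv: "Poly_Mapping.keys mdiv \<subseteq> insert Infty ((\<lambda>c. Aff c (poly V c)) ` {c. poly U c = 0})"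
proof
  fix P assume "P \<in> Poly_Mapping.keys mdiv"
  then have "Poly_Mapping.lookup mdiv P \<noteq> 0" by (simp add: in_keys_iff)
  then show "P \<in> insert Infty ((\<lambda>c. Aff c (poly V c)) ` {c. poly U c = 0})"
    by (cases P) (auto simp: lookup_mdiv_Aff split: if_splits)
qed

lemma keys_mdiv_curve: "Poly_Mapping.keys mdiv \<subseteq> curve f"
  using keys_mdiv on_curve_root(1) by (auto simp: curve_def)

lemma mdiv_in_Div0: "mdiv \<in> Div0 f"
proof -
  have "div_degree mdiv = (\<Sum>P\<in>insert Infty ((\<lambda>c. Aff c (poly V c)) ` {c. poly U c = 0}). Poly_Mapping.lookup mdiv P)"
    using keys_mdiv finite_roots by (intro div_degree_eq_sum) auto
  also have "\<dots> = - int (degree U) + (\<Sum>c | poly U c = 0. Poly_Mapping.lookup mdiv (Aff c (poly V c)))"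
    using finite_roots by (subst sum.insert) (auto simp: lookup_mdiv_Infty sum.reindex inj_on_def)
  also have "(\<Sum>c | poly U c = 0. Poly_Mapping.lookup mdiv (Aff c (poly V c))) = (\<Sum>c | poly U c = 0. int (order c U))"
    by (intro sum.cong) (auto simp: lookup_mdiv_Aff)
  also have "\<dots> = int (degree U)"
    using sum_order_eq_degree[OF U_neq_0] by (metis of_nat_sum)
  finally show ?thesis using keys_mdiv_curve by (simp add: Div0_def)
qed

text \<open>
At unramified points the order of a polynomial in \<open>x\<close> depends only on the \<open>x\<close>-coordinate, so one
point over each root of \<open>U\<close> suffices.
\<close>

lemma U_dvd_of_loc_dvd:
  assumes "\<And>c. poly U c = 0 \<Longrightarrow> \<exists>b. on_curve c b \<and> loc_dvd c b [:U:] [:r:]"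
  shows "U dvd r"
proof (cases "r = 0")
  case False
  have r: "\<not> [:r:] \<simeq> 0" and U: "\<not> [:U:] \<simeq> 0" using False U_neq_0 const_eqc_0 by auto
  have "loc_dvd a b [:U:] [:r:]" if on: "on_curve a b" for a b
  proof (cases "poly U a = 0")
    case True
    then obtain b' where b': "on_curve a b'" "loc_dvd a b' [:U:] [:r:]" using assms by blast
    have "ord a b' [:U:] \<le> ord a b' [:r:]" using b' loc_dvd_iff[OF b'(1) r U] by blast
    then have "ord a b [:U:] \<le> ord a b [:r:]"
      using ord_const[OF on False] ord_const[OF b'(1) False] ord_U[OF on] ord_U[OF b'(1)]
        root_unramified[OF True on] root_unramified[OF True b'(1)] by simp
    then show ?thesis using loc_dvd_iff[OF on r U] by blast
  next
    case f: False
    then have "ord a b [:U:] = 0" by (intro ord_unit[OF on]) simp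
    then show ?thesis using loc_dvd_iff[OF on r U] ord_nonneg by metis
  qed
  then obtain T where T: "[:r:] \<simeq> [:U:] * T" using dvd_of_loc_dvd_const[OF U_neq_0] by blast
  obtain T' where T': "T' \<in> coord_funs" "T \<simeq> T'" using reduced_exists by blast
  have "[:r:] \<simeq> [:U:] * T'" by (rule eqc_trans[OF T]) (intro eqc_mult eqc_refl T')
  moreover have "[:U:] * T' \<in> coord_funs" using T'(1) by (auto simp: coord_funs_def)
  ultimately have "[:r:] = [:U:] * T'" by (intro reduced_eqc_eq) auto
  then have "coeff [:r:] 0 = coeff ([:U:] * T') 0" by simp
  then show ?thesis by simp
qed simp

text \<open>
Membership in the ideal of the divisor. Since \<open>V\<close> has no zero at the roots of \<open>U\<close>, the
function \<open>U\<close> is a local equation of the divisor at each of its points.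
\<close>

definition vanishes :: "'a poly poly \<Rightarrow> bool" where
  "vanishes F \<longleftrightarrow> (\<forall>c. poly U c = 0 \<longrightarrow> loc_dvd c (poly V c) [:U:] F)"

lemma vanishes_iff_ord:
  assumes "\<not> F \<simeq> 0"
  shows "vanishes F \<longleftrightarrow> (\<forall>a b. on_curve a b \<longrightarrow> Poly_Mapping.lookup mdiv (Aff a b) \<le> ord a b F)"
proof -
  have U: "\<not> [:U:] \<simeq> 0" using U_neq_0 const_eqc_0 by auto
  show ?thesis
  proof (intro iffI allI impI)
    fix a b assume v: "vanishes F" and on: "on_curve a b"
    show "Poly_Mapping.lookup mdiv (Aff a b) \<le> ord a b F"
    proof (cases "poly U a = 0 \<and> b = poly V a")
      case True
      then have "loc_dvd a b [:U:] F" using v by (auto simp: vanishes_def)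
      then show ?thesis using loc_dvd_iff[OF on assms U] ord_U[OF on] True
        by (simp only: lookup_mdiv_Aff if_True simp_thms)
    next
      case False
      then have "Poly_Mapping.lookup mdiv (Aff a b) = 0" by (simp only: lookup_mdiv_Aff if_False)
      then show ?thesis using ord_nonneg by simp
    qed
  next
    assume *: "\<forall>a b. on_curve a b \<longrightarrow> Poly_Mapping.lookup mdiv (Aff a b) \<le> ord a b F"
    show "vanishes F" unfolding vanishes_def
    proof (intro allI impI)
      fix c assume c: "poly U c = 0"
      have on: "on_curve c (poly V c)" using c by (rule on_curve_root)
      then have "ord c (poly V c) [:U:] \<le> ord c (poly V c) F" using * ord_U[OF on] c
        by (metis lookup_mdiv_Aff)
      then show "loc_dvd c (poly V c) [:U:] F" using loc_dvd_iff[OF on assms U] by blast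
    qed
  qed
qed

lemma vanishes_U: "vanishes [:U:]"
  unfolding vanishes_def loc_dvd_def by (intro allI impI exI[of _ 1]) auto

text \<open>
The factor \<open>y + V\<close> is a unit at the points of the divisor, and \<open>(y + V) (y - V) = f - V\<^sup>2\<close> is a multiple
of \<open>U\<close>.
\<close>

lemma vanishes_y_minus_V: "vanishes [:- V, 1:]"
  unfolding vanishes_def
proof (intro allI impI)
  fix c assume c: "poly U c = 0"
  have "[:V, 1:] * [:- V, 1:] = [:0, 1:] * [:0, 1:] - [:V\<^sup>2:]" by (simp add: power2_eq_square)
  also have "\<dots> \<simeq> [:f:] - [:V\<^sup>2:]" by (intro eqc_diff eqc_refl y_squared)
  also have "\<dots> = [:f - V\<^sup>2:]" by simp
  also have "\<dots> = [:U:] * [:W:]" by (simp add: f_eq)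
  finally show "loc_dvd c (poly V c) [:U:] [:- V, 1:]"
    unfolding loc_dvd_def using V_nonzero[OF c] two_neq_0
    by (intro exI[of _ "[:W:]"] exI[of _ "[:V, 1:]"]) (auto simp flip: mult_2)
qed

lemma vanishes_diff:
  assumes "vanishes F" "vanishes G" shows "vanishes (F - G)"
  unfolding vanishes_def
proof (intro allI impI)
  fix c assume c: "poly U c = 0"
  obtain u v where uv: "eval2 v c (poly V c) \<noteq> 0" "v * F \<simeq> [:U:] * u"
    using assms(1) c unfolding vanishes_def loc_dvd_def by blast
  obtain u' v' where uv': "eval2 v' c (poly V c) \<noteq> 0" "v' * G \<simeq> [:U:] * u'"
    using assms(2) c unfolding vanishes_def loc_dvd_def by blast
  have "(v * v') * (F - G) = v' * (v * F) - v * (v' * G)" by (simp add: algebra_simps)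
  also have "\<dots> \<simeq> v' * ([:U:] * u) - v * ([:U:] * u')" by (intro eqc_diff eqc_mult eqc_refl uv uv')
  also have "\<dots> = [:U:] * (v' * u - v * u')" by (simp only: right_diff_distrib ac_simps)
  finally show "loc_dvd c (poly V c) [:U:] (F - G)"
    unfolding loc_dvd_def using uv uv' by (intro exI[of _ "v' * u - v * u'"] exI[of _ "v * v'"]) auto
qed

lemma vanishes_const: "vanishes [:r:] \<Longrightarrow> U dvd r"
  using U_dvd_of_loc_dvd[of r] on_curve_root(1) unfolding vanishes_def by blast

end

section \<open>Rationality of a Mumford pair\<close>

locale rational_curve = odd_curve f + subfield_projection K0 L
  for f :: "'a::alg_closed_field poly" and K0 :: "'a set" and L +
  assumes f_over: "f \<in> polys_over K0"
begin

definition over :: "'a poly poly \<Rightarrow> bool" where "over F \<longleftrightarrow> (\<forall>i. coeff F i \<in> polys0)"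

lemma coord_funs_over_iff: "F \<in> coord_funs_over K0 \<longleftrightarrow> F \<in> coord_funs \<and> over F"
  by (simp add: coord_funs_over_def over_def)

lemma over_mult: "over F \<Longrightarrow> over G \<Longrightarrow> over (F * G)"
  unfolding over_def by (auto simp: coeff_mult intro!: polys0_sum polys0_closed)

lemma over_pCons: "over (pCons p F) \<longleftrightarrow> p \<in> polys0 \<and> over F"
  unfolding over_def by (auto simp: coeff_pCons split: nat.splits)

lemma over_0: "over 0" by (simp add: over_def polys0_closed)

lemma projpp_eqc: assumes "F \<simeq> G" shows "projpp F \<simeq> projpp G"
proof -
  obtain Z where "F - G = [:- f, 0, 1:] * Z" using assms by (auto simp: eq_on_curve_def)
  then have F: "F = G + [:- f, 0, 1:] * Z" by (simp add: algebra_simps)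
  have "over [:- f, 0, 1:]" using f_over by (simp add: over_pCons over_0 polys0_closed)
  then have "projpp F = projpp G + [:- f, 0, 1:] * projpp Z"
    unfolding F projpp_add by (subst projpp_mult) (auto simp: over_def)
  then have "projpp F - projpp G = [:- f, 0, 1:] * projpp Z" by (simp only: add_diff_cancel_left')
  then show ?thesis unfolding eq_on_curve_def by (metis dvd_triv_left)
qed

lemma projpp_over_mult: "over F \<Longrightarrow> projpp (F * G) = F * projpp G"
  by (rule projpp_mult) (simp add: over_def)

text \<open>
The step that replaces descent theory. Local divisibility on the open set \<open>H \<noteq> 0\<close> is a single equation
\<open>H ^ k * (G * S) = F * T\<close> in the coordinate ring, and the projection may be applied to \<open>S\<close> and \<open>T\<close>
because the other factors are over \<open>K0\<close>.
\<close>

lemma projpp_loc_dvd: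
  assumes F: "\<not> F \<simeq> 0" and over: "over F" "over G" "over H"
    and loc: "\<And>a b. on_curve a b \<Longrightarrow> eval2 H a b \<noteq> 0 \<Longrightarrow> loc_dvd a b F (G * S)"
    and on: "on_curve a b" and H: "eval2 H a b \<noteq> 0"
  shows "loc_dvd a b F (G * projpp S)"
proof -
  obtain k T where T: "H ^ k * (G * S) \<simeq> F * T" using dvd_of_loc_dvd[OF F loc] by blast
  have "projpp (H ^ k * X) = H ^ k * projpp X" for X
    by (induction k) (simp_all add: mult.assoc projpp_over_mult over)
  then have "H ^ k * (G * projpp S) \<simeq> F * projpp T"
    using projpp_eqc[OF T] by (simp add: projpp_over_mult over)
  then show ?thesis unfolding loc_dvd_def using H by (intro exI[of _ "projpp T"] exI[of _ "H ^ k"]) auto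
qed

lemma local_equation:
  assumes "div_defined_over f K0 D" "on_curve a b"
  obtains F G H where "over F" "over G" "over H" "F \<in> coord_funs" "G \<in> coord_funs" "F \<noteq> 0" "G \<noteq> 0"
    "eval2 H a b \<noteq> 0"
    "\<And>x y. on_curve x y \<Longrightarrow> eval2 H x y \<noteq> 0 \<Longrightarrow> Poly_Mapping.lookup D (Aff x y) = ord x y F - ord x y G"
proof -
  have P: "Aff a b \<in> curve f" using assms(2) by (simp add: curve_def)
  obtain N F G where N: "basic_open f K0 N" "Aff a b \<in> N"
    and FG: "F \<in> coord_funs_over K0" "G \<in> coord_funs_over K0" "F \<noteq> 0" "G \<noteq> 0"
      "\<forall>Q\<in>N. Poly_Mapping.lookup D Q = ord_at f Q F - ord_at f Q G"
    using assms(1) P unfolding div_defined_over_def by blast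
  obtain H where H: "H \<in> coord_funs_over K0" "H \<noteq> 0"
    "let A = {Aff a b | a b. Aff a b \<in> curve f \<and> eval2 H a b \<noteq> 0} in N = A \<or> N = insert Infty A"
    using N(1) unfolding basic_open_def by blast
  have mem: "Aff x y \<in> N \<longleftrightarrow> on_curve x y \<and> eval2 H x y \<noteq> 0" for x y
    using H(3) by (auto simp: Let_def curve_def)
  show ?thesis
    by (rule that[of F G H])
       (use FG H(1) N(2) mem in \<open>auto simp: coord_funs_over_iff simp del: ord_at.simps\<close>)
qed

lemma reduced_not_0: "F \<in> coord_funs \<Longrightarrow> F \<noteq> 0 \<Longrightarrow> \<not> F \<simeq> 0"
  using reduced_eqc_0 by blast

text \<open>
Multiply the norms of the local numerators of \<open>D\<close> at the finitely many points of its support.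
\<close>

lemma denominator_over:
  assumes D: "div_defined_over f K0 D"
  obtains m where "m \<in> polys0" "m \<noteq> 0"
    "\<And>a b. on_curve a b \<Longrightarrow> Poly_Mapping.lookup D (Aff a b) \<le> ord a b [:m:]"
proof -
  define A where "A = {(a, b). Aff a b \<in> Poly_Mapping.keys D}"
  have "finite A"
  proof -
    have "A = (\<lambda>(a, b). Aff a b) -` Poly_Mapping.keys D" by (auto simp: A_def)
    then show ?thesis by (simp add: finite_vimageI inj_on_def)
  qed
  have onA: "on_curve a b" if "(a, b) \<in> A" for a b
    using that D unfolding A_def div_defined_over_def by (auto simp: curve_def)
  have "\<exists>m. m \<in> polys0 \<and> m \<noteq> 0 \<and> Poly_Mapping.lookup D (Aff (fst P) (snd P)) \<le> ord (fst P) (snd P) [:m:]"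
    if "P \<in> A" for P
  proof -
    obtain a b where P: "P = (a, b)" by (cases P)
    have on: "on_curve a b" using onA \<open>P \<in> A\<close> P by blast
    obtain F G H where FG: "over F" "F \<in> coord_funs" "F \<noteq> 0"
      "Poly_Mapping.lookup D (Aff a b) = ord a b F - ord a b G"
      using local_equation[OF D on] on by metis
    have n0: "norm_poly F \<noteq> 0" using degree_norm_poly(1) FG by blast
    have c0: "\<not> conjugate F \<simeq> 0"
    proof (rule reduced_not_0)
      show "conjugate F \<noteq> 0" using FG(2,3) reduced_eq_pair[of F] by (auto simp: conjugate_def)
    qed (simp add: conjugate_def)
    have F0: "\<not> F \<simeq> 0" using reduced_not_0 FG by blast
    then have FC: "\<not> F * conjugate F \<simeq> 0" using c0 eqc_mult_0 by blast
    have "ord a b [:norm_poly F:] = ord a b (F * conjugate F)" using ord_cong[OF on FC mult_conjugate[OF FG(2)]] by simp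
    also have "\<dots> = ord a b F + ord a b (conjugate F)" by (rule ord_mult[OF on F0 c0])
    finally have "Poly_Mapping.lookup D (Aff a b) \<le> ord a b [:norm_poly F:]"
      using FG(4) ord_nonneg[of a b G] ord_nonneg[of a b "conjugate F"] by linarith
    moreover have "norm_poly F \<in> polys0" unfolding norm_poly_def
      using FG(1) f_over by (intro polys0_closed) (auto simp: over_def)
    ultimately show ?thesis using n0 P by auto
  qed
  then obtain h where h: "\<And>P. P \<in> A \<Longrightarrow> h P \<in> polys0 \<and> h P \<noteq> 0 \<and>
      Poly_Mapping.lookup D (Aff (fst P) (snd P)) \<le> ord (fst P) (snd P) [:h P:]" by metis
  define m where "m = prod h A"
  have m0: "m \<noteq> 0" using h \<open>finite A\<close> by (simp add: m_def)
  show ?thesis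
  proof
    show "m \<in> polys0" unfolding m_def using h by (intro polys0_prod) auto
    show "m \<noteq> 0" by (fact m0)
    fix a b assume on: "on_curve a b"
    show "Poly_Mapping.lookup D (Aff a b) \<le> ord a b [:m:]"
    proof (cases "(a, b) \<in> A")
      case True
      define w where "w = prod h (A - {(a, b)})"
      have m: "m = h (a, b) * w" unfolding m_def w_def using True \<open>finite A\<close> by (rule prod.remove[rotated])
      have "\<not> [:h (a, b):] \<simeq> 0" "\<not> [:w:] \<simeq> 0" using m0 m const_eqc_0 by auto
      then have "ord a b ([:h (a, b):] * [:w:]) = ord a b [:h (a, b):] + ord a b [:w:]"
        by (rule ord_mult[OF on])
      moreover have "[:m:] = [:h (a, b):] * [:w:]" by (simp add: m)
      ultimately show ?thesis using h[OF True] ord_nonneg[of a b "[:w:]"]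
        by (simp only: fst_conv snd_conv) linarith
    next
      case False
      then have "Poly_Mapping.lookup D (Aff a b) = 0" by (simp add: A_def in_keys_iff)
      then show ?thesis by simp
    qed
  qed
qed

lemma principal_0: "principal f 0"
  unfolding principal_def by (intro conjI bexI[of _ 1]) (auto simp: coord_funs_def)

lemma cl_eqD:
  assumes "cl f D = cl f E" "E \<in> Div0 f"
  shows "principal f (D - E)"
proof -
  have "E \<in> cl f E" using assms(2) principal_0 by (simp only: cl_def lin_equiv_def) simp
  then show ?thesis using assms(1) by (auto simp: cl_def lin_equiv_def)
qed

end

locale rational_mumford_pair = mumford_pair f U V W + rational_curve f K0 L
  for f U V W :: "'a::alg_closed_field poly" and K0 :: "'a set" and L
begin

abbreviation coeff_at :: "'a divisor \<Rightarrow> 'a \<Rightarrow> 'a \<Rightarrow> int" where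
  "coeff_at D a b \<equiv> Poly_Mapping.lookup D (Aff a b)"

lemma ord_const_unit: "on_curve a b \<Longrightarrow> k \<noteq> 0 \<Longrightarrow> ord a b [:[:k:]:] = 0"
  by (rule ord_unit) auto

text \<open>
Multiplying by \<open>m\<close> clears the finite poles of the function that links the two divisors. The normalisation
of one coefficient to 1 guarantees that the projected function is not zero.
\<close>

lemma regular_function_exists:
  assumes D: "principal f (mdiv - D)" and m: "m \<noteq> 0"
    and le: "\<And>a b. on_curve a b \<Longrightarrow> coeff_at D a b \<le> ord a b [:m:]"
  obtains T i j where "T \<in> coord_funs" "T \<noteq> 0" "coeff (coeff T i) j = 1"
    "\<And>a b. on_curve a b \<Longrightarrow> ord a b T = ord a b [:m:] + coeff_at mdiv a b - coeff_at D a b"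
proof -
  obtain F G where FG: "F \<in> coord_funs" "G \<in> coord_funs" "F \<noteq> 0" "G \<noteq> 0"
    "\<And>P. P \<in> curve f \<Longrightarrow> Poly_Mapping.lookup (mdiv - D) P = ord_at f P F - ord_at f P G"
    using D unfolding principal_def by blast
  have F0: "\<not> F \<simeq> 0" and G0: "\<not> G \<simeq> 0" using FG reduced_not_0 by auto
  have m0: "\<not> [:m:] \<simeq> 0" using m const_eqc_0 by blast
  have mF: "\<not> [:m:] * F \<simeq> 0" using eqc_mult_0 m0 F0 by blast
  have eq: "coeff_at mdiv a b - coeff_at D a b = ord a b F - ord a b G" if "on_curve a b" for a b
    using FG(5)[of "Aff a b"] that by (simp add: curve_def lookup_minus)
  have "loc_dvd a b G ([:m:] * F)" if on: "on_curve a b" for a b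
  proof -
    have "coeff_at mdiv a b \<ge> 0" by (simp add: lookup_mdiv_Aff)
    then have "ord a b G \<le> ord a b [:m:] + ord a b F" using eq[OF on] le[OF on] by linarith
    then have "ord a b G \<le> ord a b ([:m:] * F)" by (simp only: ord_mult[OF on m0 F0])
    then show ?thesis using loc_dvd_iff[OF on mF G0] by blast
  qed
  then obtain k T where "1 ^ k * ([:m:] * F) \<simeq> G * T"
    using dvd_of_loc_dvd[OF G0, of 1 "[:m:] * F"] by blast
  then have T: "[:m:] * F \<simeq> G * T" by simp
  obtain T1 where T1: "T1 \<in> coord_funs" "T \<simeq> T1" using reduced_exists by blast
  have T2: "[:m:] * F \<simeq> G * T1" by (rule eqc_trans[OF T]) (intro eqc_mult eqc_refl T1)
  have T10: "T1 \<noteq> 0" using T2 mF by auto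
  have T1': "\<not> T1 \<simeq> 0" using reduced_not_0 T1(1) T10 by blast
  have ordT1: "ord a b T1 = ord a b [:m:] + coeff_at mdiv a b - coeff_at D a b" if on: "on_curve a b" for a b
  proof -
    have "ord a b [:m:] + ord a b F = ord a b ([:m:] * F)" by (simp only: ord_mult[OF on m0 F0])
    also have "\<dots> = ord a b (G * T1)" by (rule ord_cong[OF on mF T2])
    also have "\<dots> = ord a b G + ord a b T1" by (rule ord_mult[OF on G0 T1'])
    finally show ?thesis using eq[OF on] by linarith
  qed
  obtain i where i: "coeff T1 i \<noteq> 0" using T10 by (metis poly_eq_iff coeff_0)
  obtain j where j: "coeff (coeff T1 i) j \<noteq> 0" using i by (metis poly_eq_iff coeff_0)
  define k where "k = inverse (coeff (coeff T1 i) j)"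
  have k: "k \<noteq> 0" using j by (simp add: k_def)
  have kc: "\<not> [:[:k:]:] \<simeq> 0" using k const_eqc_0[of "[:k:]"] by simp
  define T2 where "T2 = [:[:k:]:] * T1"
  show ?thesis
  proof (rule that[of T2 i j])
    show "T2 \<in> coord_funs" using T1(1) by (auto simp: T2_def coord_funs_def)
    show "T2 \<noteq> 0" using T10 k by (simp add: T2_def)
    show "coeff (coeff T2 i) j = 1" using j by (simp add: T2_def k_def)
    show "ord a b T2 = ord a b [:m:] + coeff_at mdiv a b - coeff_at D a b" if on: "on_curve a b" for a b
      unfolding T2_def ord_mult[OF on kc T1'] ord_const_unit[OF on k] ordT1[OF on] by simp
  qed
qed

lemma degree_norm_poly_projpp:
  assumes "T \<in> coord_funs" "T \<noteq> 0" "projpp T \<noteq> 0"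
  shows "degree (norm_poly (projpp T)) \<le> degree (norm_poly T)"
proof -
  have r: "projpp T \<in> coord_funs"
    using assms(1) degree_projpp[of T] by (auto simp: coord_funs_def)
  have "ord_at f Infty T \<le> ord_at f Infty (projpp T)"
    using degree_projp[of "coeff T 0"] degree_projp[of "coeff T 1"]
    by (auto simp: coeff_projpp)
  then show ?thesis using degree_norm_poly(2)[OF assms(1,2)] degree_norm_poly(2)[OF r assms(3)] by linarith
qed

text \<open>
The divisor \<open>D\<close> of the pair is reduced, so the only functions with poles at most \<open>D\<close> are
the constants. Here \<open>T'/T\<close> is such a function. Then \<open>S = U T'/T\<close> is regular with pole order at most
\<open>2 * degree U\<close> at infinity, which is less than the pole order of \<open>y\<close>; so \<open>S\<close> is a polynomial in \<open>x\<close> of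
degree at most that of \<open>U\<close>. It vanishes on the conjugate of \<open>D\<close>, where \<open>U\<close> vanishes but \<open>T'/T\<close> has no pole.
So \<open>U\<close> divides \<open>S\<close>.
\<close>

lemma proportional_of_ord_ge:
  assumes T: "T \<in> coord_funs" "T \<noteq> 0" and T': "T' \<in> coord_funs" "T' \<noteq> 0"
    and deg: "degree (norm_poly T') \<le> degree (norm_poly T)"
    and ge: "\<And>a b. on_curve a b \<Longrightarrow> ord a b T \<le> ord a b T' + coeff_at mdiv a b"
  shows "\<exists>k. k \<noteq> 0 \<and> T' \<simeq> [:[:k:]:] * T"
proof -
  have T0: "\<not> T \<simeq> 0" "\<not> T' \<simeq> 0" using T T' reduced_not_0 by auto
  have U0: "\<not> [:U:] \<simeq> 0" using U_neq_0 const_eqc_0 by blast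
  have TU: "\<not> T' * [:U:] \<simeq> 0" using eqc_mult_0 T0 U0 by blast
  have dU: "coeff_at mdiv a b \<le> ord a b [:U:]" if "on_curve a b" for a b
    using ord_U[OF that] by (simp add: lookup_mdiv_Aff)
  have "loc_dvd a b T (T' * [:U:])" if on: "on_curve a b" for a b
  proof -
    have "ord a b T \<le> ord a b (T' * [:U:])"
      unfolding ord_mult[OF on T0(2) U0] using ge[OF on] dU[OF on] by linarith
    then show ?thesis using loc_dvd_iff[OF on TU T0(1)] by blast
  qed
  then obtain k S0 where "1 ^ k * (T' * [:U:]) \<simeq> T * S0"
    using dvd_of_loc_dvd[OF T0(1), of 1 "T' * [:U:]"] by blast
  then have S0: "T' * [:U:] \<simeq> T * S0" by simp
  obtain S where S: "S \<in> coord_funs" "S0 \<simeq> S" using reduced_exists by blast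
  have TS: "T' * [:U:] \<simeq> T * S" by (rule eqc_trans[OF S0]) (intro eqc_mult eqc_refl S)
  have S0: "S \<noteq> 0" using TS TU by auto
  obtain Z where Z: "Z \<in> coord_funs" "T * S \<simeq> Z" using reduced_exists by blast
  have "norm_poly T' * norm_poly [:U:] = norm_poly T * norm_poly S"
    using norm_poly_mult[OF eqc_trans[OF TS Z(2)] T'(1) _ Z(1)] norm_poly_mult[OF Z(2) T(1) S(1) Z(1)] by simp
  then have "degree (norm_poly T') + degree (norm_poly [:U:]) = degree (norm_poly T) + degree (norm_poly S)"
    using degree_norm_poly(1)[OF T] degree_norm_poly(1)[OF T'] degree_norm_poly(1)[OF S(1) S0] degree_norm_poly(1)[of "[:U:]"] U_neq_0
    by (metis degree_mult_eq pair_in_coord_funs(2) pCons_eq_0_iff)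
  moreover have "degree (norm_poly [:U:]) = 2 * degree U" using U_neq_0 by (simp add: norm_poly_def degree_power_eq)
  ultimately have "degree (norm_poly S) \<le> 2 * degree U" using deg by linarith
  then have "- ord_at f Infty S \<le> 2 * int (degree U)" using degree_norm_poly(2)[OF S(1) S0] by linarith
  then have s: "coeff S 1 = 0" and r: "degree (coeff S 0) \<le> degree U"
    using degree_U by (auto split: if_splits)
  define r where "r = coeff S 0"
  have Sr: "S = [:r:]" using reduced_eq_pair[OF S(1)] s by (simp add: r_def)
  have r0: "\<not> [:r:] \<simeq> 0" using S0 Sr const_eqc_0 by auto
  have "U dvd r"
  proof (rule U_dvd_of_loc_dvd)
    fix c assume c: "poly U c = 0"
    let ?b = "- poly V c"
    have on: "on_curve c ?b" using c by (rule on_curve_root)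
    have "?b \<noteq> poly V c"
    proof
      assume "?b = poly V c"
      then have "2 * poly V c = 0" by (metis add.right_inverse mult_2)
      then show False using two_neq_0 V_nonzero[OF c] by simp
    qed
    then have "coeff_at mdiv c ?b = 0" by (simp add: lookup_mdiv_Aff)
    then have *: "ord c ?b T \<le> ord c ?b T'" using ge[OF on] by simp
    have "ord c ?b T' + ord c ?b [:U:] = ord c ?b (T' * [:U:])" by (simp only: ord_mult[OF on T0(2) U0])
    also have "\<dots> = ord c ?b (T * [:r:])" using ord_cong[OF on TU TS] Sr by simp
    also have "\<dots> = ord c ?b T + ord c ?b [:r:]" by (rule ord_mult[OF on T0(1) r0])
    finally have "ord c ?b [:U:] \<le> ord c ?b [:r:]" using * by linarith
    then show "\<exists>b. on_curve c b \<and> loc_dvd c b [:U:] [:r:]"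
      using loc_dvd_iff[OF on r0 U0] on by blast
  qed
  then obtain q where q: "r = U * q" by (auto elim: dvdE)
  have q0: "q \<noteq> 0" using q r0 by auto
  have "degree q = 0" using r U_neq_0 q0 unfolding r_def[symmetric] q by (simp add: degree_mult_eq)
  then obtain k where k: "q = [:k:]" by (rule degree_eq_zeroE)
  have "[:U:] * T' = T' * [:U:]" by (simp only: mult.commute)
  also note TS
  also have "T * S = [:U:] * ([:[:k:]:] * T)" unfolding Sr q k
    by (simp add: mult.commute)
  finally have "T' \<simeq> [:[:k:]:] * T" using eqc_cancel U0 by blast
  then show ?thesis using q0 k by auto
qed

text \<open>
The ideal of the divisor is stable under the projection as soon as the class contains a divisor
\<open>D\<close> over \<open>K0\<close>, because then the divisor of the pair has local equations over \<open>K0\<close>.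
\<close>

lemma vanishes_projpp:
  assumes D: "principal f (mdiv - D)" "div_defined_over f K0 D" and F: "vanishes F"
  shows "vanishes (projpp F)"
proof (cases "F \<simeq> 0 \<or> projpp F \<simeq> 0")
  case True
  have "projpp F \<simeq> 0"
  proof (cases "F \<simeq> 0")
    case True
    from projpp_eqc[OF True] show ?thesis by (simp add: projpp_def)
  qed (use True in blast)
  then show ?thesis by (auto simp: vanishes_def intro: loc_dvd_0)
next
  case False
  then have F0: "\<not> F \<simeq> 0" and F'0: "\<not> projpp F \<simeq> 0" by auto
  obtain m where m: "m \<in> polys0" "m \<noteq> 0" "\<And>a b. on_curve a b \<Longrightarrow> coeff_at D a b \<le> ord a b [:m:]"
    using denominator_over[OF D(2)] by blast
  have m0: "\<not> [:m:] \<simeq> 0" and m_over: "over [:m:]"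
    using m const_eqc_0 by (auto simp: over_pCons over_0)
  obtain T i j where T: "T \<in> coord_funs" "T \<noteq> 0" "coeff (coeff T i) j = 1"
    and ordT: "\<And>a b. on_curve a b \<Longrightarrow> ord a b T = ord a b [:m:] + coeff_at mdiv a b - coeff_at D a b"
    using regular_function_exists[OF D(1) m(2,3)] by blast
  define T' where "T' = projpp T"
  have "coeff (coeff T' i) j = 1" using T(3) by (simp add: T'_def coeff_projpp coeff_projp proj_id sub_closed)
  then have T': "T' \<noteq> 0" "T' \<in> coord_funs" "over T'"
    using T(1) degree_projpp[of T] by (auto simp: T'_def coord_funs_def over_def projpp_coeff_in)
  have T0: "\<not> T \<simeq> 0" and T'0: "\<not> T' \<simeq> 0" using T T' reduced_not_0 by auto
  have mdiv_nonneg: "coeff_at mdiv a b \<ge> 0" for a b by (simp add: lookup_mdiv_Aff)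
  \<comment> \<open>With \<open>A / B\<close> the local equation of \<open>D\<close>, the lower bound \<open>div m - D\<close> for \<open>T\<close> has the local equation \<open>m B / A\<close> over \<open>K0\<close>.\<close>
  have ordT': "ord a b [:m:] - coeff_at D a b \<le> ord a b T'" if on: "on_curve a b" for a b
  proof -
    obtain A B H where loc: "over A" "over B" "over H" "A \<in> coord_funs" "B \<in> coord_funs" "A \<noteq> 0" "B \<noteq> 0"
      "eval2 H a b \<noteq> 0" "\<And>x y. on_curve x y \<Longrightarrow> eval2 H x y \<noteq> 0 \<Longrightarrow> coeff_at D x y = ord x y A - ord x y B"
      using local_equation[OF D(2) on] by blast
    have A0: "\<not> A \<simeq> 0" and B0: "\<not> B \<simeq> 0" using loc reduced_not_0 by auto
    have mB: "\<not> [:m:] * B \<simeq> 0" and AT: "\<not> A * T \<simeq> 0" and AT': "\<not> A * T' \<simeq> 0"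
      using eqc_mult_0 m0 A0 B0 T0 T'0 by blast+
    have "loc_dvd x y ([:m:] * B) (A * T)" if on': "on_curve x y" and H: "eval2 H x y \<noteq> 0" for x y
    proof -
      have "ord x y ([:m:] * B) \<le> ord x y (A * T)"
        unfolding ord_mult[OF on' m0 B0] ord_mult[OF on' A0 T0]
        using loc(9)[OF on' H] ordT[OF on'] mdiv_nonneg[of x y] by linarith
      then show ?thesis using loc_dvd_iff[OF on' AT mB] by blast
    qed
    from projpp_loc_dvd[OF mB over_mult[OF m_over loc(2)] loc(1,3) this on loc(8)]
    have "ord a b ([:m:] * B) \<le> ord a b (A * T')"
      using loc_dvd_iff[OF on AT' mB] by (simp add: T'_def)
    then show ?thesis
      unfolding ord_mult[OF on m0 B0] ord_mult[OF on A0 T'0] using loc(9)[OF on loc(8)] by linarith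
  qed
  have "degree (norm_poly T') \<le> degree (norm_poly T)" unfolding T'_def
    using degree_norm_poly_projpp[OF T(1,2)] T'(1) by (simp add: T'_def)
  moreover have "ord a b T \<le> ord a b T' + coeff_at mdiv a b" if "on_curve a b" for a b
    using ordT[OF that] ordT'[OF that] by linarith
  ultimately obtain k where k: "k \<noteq> 0" "T' \<simeq> [:[:k:]:] * T"
    using proportional_of_ord_ge[OF T(1,2) T'(2,1)] by blast
  have kc: "\<not> [:[:k:]:] \<simeq> 0" using k const_eqc_0[of "[:k:]"] by simp
  \<comment> \<open>So \<open>T'\<close> has the same divisor as \<open>T\<close>, which gives the divisor of the pair the local equation \<open>T' A / (m B)\<close>.\<close>
  have ordT'_eq: "ord a b T' = ord a b [:m:] + coeff_at mdiv a b - coeff_at D a b" if on: "on_curve a b" for a b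
    using ord_cong[OF on T'0 k(2)] ord_mult[OF on kc T0] ord_const_unit[OF on k(1)] ordT[OF on] by simp
  show ?thesis
    unfolding vanishes_iff_ord[OF F'0]
  proof (intro allI impI)
    fix a b assume on: "on_curve a b"
    obtain A B H where loc: "over A" "over B" "over H" "A \<in> coord_funs" "B \<in> coord_funs" "A \<noteq> 0" "B \<noteq> 0"
      "eval2 H a b \<noteq> 0" "\<And>x y. on_curve x y \<Longrightarrow> eval2 H x y \<noteq> 0 \<Longrightarrow> coeff_at D x y = ord x y A - ord x y B"
      using local_equation[OF D(2) on] by blast
    have A0: "\<not> A \<simeq> 0" and B0: "\<not> B \<simeq> 0" using loc reduced_not_0 by auto
    have TA: "\<not> T' * A \<simeq> 0" and mB: "\<not> [:m:] * B \<simeq> 0" using eqc_mult_0 m0 A0 B0 T'0 by blast+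
    have mBF: "\<not> ([:m:] * B) * F \<simeq> 0" "\<not> ([:m:] * B) * projpp F \<simeq> 0" using eqc_mult_0 mB F0 F'0 by blast+
    have "loc_dvd x y (T' * A) (([:m:] * B) * F)" if on': "on_curve x y" and H: "eval2 H x y \<noteq> 0" for x y
    proof -
      have "coeff_at mdiv x y \<le> ord x y F" using F on' vanishes_iff_ord[OF F0] by blast
      then have "ord x y (T' * A) \<le> ord x y (([:m:] * B) * F)"
        unfolding ord_mult[OF on' mB F0] ord_mult[OF on' m0 B0] ord_mult[OF on' T'0 A0]
        using loc(9)[OF on' H] ordT'_eq[OF on'] by linarith
      then show ?thesis using loc_dvd_iff[OF on' mBF(1) TA] by blast
    qed
    from projpp_loc_dvd[OF TA over_mult[OF T'(3) loc(1)] over_mult[OF m_over loc(2)] loc(3) this on loc(8)]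
    have "ord a b (T' * A) \<le> ord a b (([:m:] * B) * projpp F)"
      using loc_dvd_iff[OF on mBF(2) TA] by simp
    then show "coeff_at mdiv a b \<le> ord a b (projpp F)"
      unfolding ord_mult[OF on mB F'0] ord_mult[OF on m0 B0] ord_mult[OF on T'0 A0]
      using loc(9)[OF on loc(8)] ordT'_eq[OF on] by linarith
  qed
qed

lemma small_multiple_0: "U dvd r \<Longrightarrow> r = 0 \<or> degree r < degree U \<Longrightarrow> r = 0"
  using dvd_imp_degree_le[of U r] by linarith

text \<open>
The functions \<open>U\<close> and \<open>y - V\<close> generate the ideal of the divisor. Their projections are in the ideal
too, with the same leading terms, and the differences are polynomials in \<open>x\<close> of degree less than that of
\<open>U\<close>.
\<close>

lemma coeffs_over_of_class_over:
  assumes "mumford_point f U V \<in> jacobian_over f K0"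
  shows "U \<in> polys0 \<and> V \<in> polys0"
proof -
  obtain D where D: "cl f mdiv = cl f D" "D \<in> Div0 f" "div_defined_over f K0 D"
    using assms unfolding mumford_point_eq jacobian_over_def by blast
  have pr: "principal f (mdiv - D)" using cl_eqD D by blast
  have U1: "coeff U (degree U) = 1" using monic by simp
  have "vanishes ([:U:] - projpp [:U:])"
    by (intro vanishes_diff vanishes_projpp[OF pr D(3)] vanishes_U)
  moreover have "[:U:] - projpp [:U:] = [:U - projp U:]"
    by (intro poly_eqI) (simp add: coeff_projpp coeff_pCons split: nat.splits)
  ultimately have "U dvd U - projp U" using vanishes_const by simp
  moreover have "U - projp U = 0 \<or> degree (U - projp U) < degree U"
  proof (rule disjCI)
    assume "\<not> degree (U - projp U) < degree U"
    moreover have "degree (U - projp U) \<le> degree U" by (intro degree_diff_le degree_projp order_refl)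
    ultimately have "degree (U - projp U) = degree U" by simp
    moreover have "coeff (U - projp U) (degree U) = 0"
      using U1 by (simp add: coeff_projp proj_id sub_closed)
    ultimately show "U - projp U = 0" by (metis leading_coeff_0_iff)
  qed
  ultimately have "U - projp U = 0" by (rule small_multiple_0)
  then have U: "U \<in> polys0" by (intro projp_fixed_imp) simp
  have "vanishes ([:- V, 1:] - projpp [:- V, 1:])"
    by (intro vanishes_diff vanishes_projpp[OF pr D(3)] vanishes_y_minus_V)
  moreover have "[:- V, 1:] - projpp [:- V, 1:] = [:- V - projp (- V):]"
    by (intro poly_eqI) (auto simp: coeff_projpp coeff_pCons projp_id polys0_closed split: nat.splits)
  ultimately have "U dvd - V - projp (- V)" using vanishes_const by simp
  moreover have "- V - projp (- V) = 0 \<or> degree (- V - projp (- V)) < degree U"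
  proof (cases "V = 0")
    case False
    then have "degree V < degree U" using degree_V by blast
    moreover have "degree (- V - projp (- V)) \<le> degree V"
      using degree_projp[of "- V"] by (intro degree_diff_le) auto
    ultimately show ?thesis by simp
  qed simp
  ultimately have "- V - projp (- V) = 0" by (rule small_multiple_0)
  then have "- V \<in> polys0" by (intro projp_fixed_imp) simp
  then show ?thesis using U polys0_closed(6)[of "- V"] by simp
qed

end

context rational_mumford_pair
begin

lemma basic_openI:
  assumes "H \<in> coord_funs" "over H" "H \<noteq> 0"
  shows "basic_open f K0 {Aff a b | a b. Aff a b \<in> curve f \<and> eval2 H a b \<noteq> 0}"
    "basic_open f K0 (insert Infty {Aff a b | a b. Aff a b \<in> curve f \<and> eval2 H a b \<noteq> 0})"
  using assms unfolding basic_open_def Let_def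
  by (intro bexI[of _ H]; simp add: coord_funs_over_iff)+

lemma over_1: "over 1" using polys0_closed by (simp add: one_pCons over_pCons over_0)

lemma one_in_coord_funs: "1 \<in> coord_funs" by (simp add: coord_funs_def)

text \<open>
A local equation at infinity built from \<open>x\<close> and \<open>y\<close>, whose pole orders are 2 and the odd number
\<open>degree f\<close>: it is \<open>x^k\<close> or \<open>y / x^k\<close> according to the parity of \<open>degree U\<close>.
\<close>

lemma order_at_infinity_over:
  obtains F G where "F \<in> coord_funs" "G \<in> coord_funs" "over F" "over G" "F \<noteq> 0" "G \<noteq> 0"
    "ord_at f Infty F - ord_at f Infty G = - int (degree U)"
    "\<And>a b. on_curve a b \<Longrightarrow> a \<noteq> 0 \<Longrightarrow> b \<noteq> 0 \<Longrightarrow> eval2 F a b \<noteq> 0 \<and> eval2 G a b \<noteq> 0"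
proof (cases "even (degree U)")
  case True
  then obtain k where k: "degree U = 2 * k" by (rule evenE)
  define F :: "'a poly poly" where "F = [:[:0, 1:] ^ k:]"
  have "[:0, 1:] ^ k \<in> polys0" by (intro polys0_closed sub_closed)
  then show ?thesis
    by (intro that[of F 1]) (auto simp: F_def k over_1 over_pCons over_0 one_in_coord_funs degree_power_eq)
next
  case False
  define k where "k = (degree f - degree U) div 2"
  have "even (degree f - degree U)" using False odd_degree by simp
  then have k: "degree f = degree U + 2 * k" using degree_U by (simp add: k_def)
  define F G :: "'a poly poly" where "F = [:0, 1:]" and "G = [:[:0, 1:] ^ k:]"
  have "[:0, 1:] ^ k \<in> polys0" by (intro polys0_closed sub_closed)
  then show ?thesis
    by (intro that[of F G])
       (auto simp: F_def G_def k over_pCons over_0 polys0_closed degree_power_eq)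
qed

lemma mdiv_defined_over:
  assumes "U \<in> polys0" "V \<in> polys0"
  shows "div_defined_over f K0 mdiv"
  unfolding div_defined_over_def
proof (intro conjI ballI keys_mdiv_curve)
  fix P assume P: "P \<in> curve f"
  have overU: "over [:U:]" using assms by (simp add: over_pCons over_0)
  show "\<exists>N. basic_open f K0 N \<and> P \<in> N \<and>
    (\<exists>F\<in>coord_funs_over K0. \<exists>G\<in>coord_funs_over K0. F \<noteq> 0 \<and> G \<noteq> 0 \<and>
      (\<forall>Q\<in>N. Poly_Mapping.lookup mdiv Q = ord_at f Q F - ord_at f Q G))"
  proof (cases P)
    case Infty
    obtain F G where FG: "F \<in> coord_funs" "G \<in> coord_funs" "over F" "over G" "F \<noteq> 0" "G \<noteq> 0"
      "ord_at f Infty F - ord_at f Infty G = - int (degree U)"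
      "\<And>a b. on_curve a b \<Longrightarrow> a \<noteq> 0 \<Longrightarrow> b \<noteq> 0 \<Longrightarrow> eval2 F a b \<noteq> 0 \<and> eval2 G a b \<noteq> 0"
      using order_at_infinity_over by blast
    \<comment> \<open>Removing the zeros of \<open>x\<close>, \<open>y\<close> and \<open>U\<close> leaves an open set on which the divisor and the local equation are concentrated at infinity.\<close>
    define H where "H = [:[:0, 1:] * U * f:]"
    have xUf: "[:0, 1:] * U * f \<in> polys0" by (intro polys0_closed sub_closed assms f_over)
    have "H \<in> coord_funs" "H \<noteq> 0" "over H" using U_neq_0 f_neq_0 xUf
      by (auto simp: H_def over_pCons over_0)
    then have "basic_open f K0 (insert Infty {Aff a b | a b. Aff a b \<in> curve f \<and> eval2 H a b \<noteq> 0})"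
      by (intro basic_openI)
    moreover have "Poly_Mapping.lookup mdiv Q = ord_at f Q F - ord_at f Q G"
      if "Q \<in> insert Infty {Aff a b | a b. Aff a b \<in> curve f \<and> eval2 H a b \<noteq> 0}" for Q
    proof (cases Q)
      case Infty
      then show ?thesis using FG(7) by (simp only: lookup_mdiv_Infty)
    next
      case (Aff a b)
      then have on: "on_curve a b" and "eval2 H a b \<noteq> 0" using that by (auto simp: curve_def)
      then have nz: "a \<noteq> 0" "poly U a \<noteq> 0" "b \<noteq> 0" by (auto simp: H_def)
      have "ord a b F = 0" "ord a b G = 0" using FG(8)[OF on nz(1,3)] ord_unit[OF on] by auto
      then show ?thesis using nz by (simp add: Aff lookup_mdiv_Aff)
    qed
    ultimately show ?thesis using FG Infty coord_funs_over_iff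
      by (intro exI[of _ "insert Infty {Aff a b | a b. Aff a b \<in> curve f \<and> eval2 H a b \<noteq> 0}"]
          conjI bexI[of _ F] bexI[of _ G] ballI) auto
  next
    case (Aff a b)
    then have on: "on_curve a b" using P by (simp add: curve_def)
    show ?thesis
    proof (cases "poly U a = 0")
      case False
      have "Poly_Mapping.lookup mdiv Q = ord_at f Q 1 - ord_at f Q 1"
        if "Q \<in> {Aff a b | a b. Aff a b \<in> curve f \<and> eval2 [:U:] a b \<noteq> 0}" for Q
        using that by (auto simp: lookup_mdiv_Aff)
      moreover have "basic_open f K0 {Aff a b | a b. Aff a b \<in> curve f \<and> eval2 [:U:] a b \<noteq> 0}"
        using U_neq_0 overU by (intro basic_openI) auto
      ultimately show ?thesis using Aff P False over_1 one_in_coord_funs coord_funs_over_iff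
        by (intro exI[of _ "{Aff a b | a b. Aff a b \<in> curve f \<and> eval2 [:U:] a b \<noteq> 0}"]
            conjI bexI[of _ 1] ballI) auto
    next
      case root: True
      \<comment> \<open>On the locus \<open>y + V \<noteq> 0\<close> the conjugate points are absent, so \<open>U\<close> is a local equation;
        on \<open>y - V \<noteq> 0\<close> the divisor is empty.\<close>
      define s where "s = (if b = poly V a then V else - V)"
      define F where "F = (if b = poly V a then [:U:] else 1)"
      have b: "b = poly V a \<or> b = - poly V a" using point_over_root[OF root on] .
      have s: "s \<in> polys0" using assms polys0_closed by (simp add: s_def)
      have F: "F \<in> coord_funs" "F \<noteq> 0" "over F"
        using overU over_1 U_neq_0 one_in_coord_funs by (auto simp: F_def)
      have "b \<noteq> 0" using root_unramified[OF root on] .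
      have es: "eval2 [:s, 1:] a b \<noteq> 0"
        using b V_nonzero[OF root] two_neq_0 by (auto simp: s_def simp flip: mult_2)
      have "Poly_Mapping.lookup mdiv Q = ord_at f Q F - ord_at f Q 1"
        if Q_in: "Q \<in> {Aff a b | a b. Aff a b \<in> curve f \<and> eval2 [:s, 1:] a b \<noteq> 0}" for Q
      proof -
        obtain x y where Q: "Q = Aff x y" and on': "on_curve x y" and e: "poly s x + y \<noteq> 0"
          using Q_in by (auto simp: curve_def add.commute)
        have o1: "ord x y 1 = 0" using ord_unit[OF on', of 1] by simp
        show ?thesis
        proof (cases "poly U x = 0")
          case True
          then have y: "y = poly V x \<or> y = - poly V x" using point_over_root on' by blast
          show ?thesis
          proof (cases "b = poly V a")
            case True
            then have "y = poly V x" using y e by (auto simp: s_def)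
            then show ?thesis using True \<open>poly U x = 0\<close> o1 ord_U[OF on']
              by (simp add: Q lookup_mdiv_Aff F_def)
          next
            case False
            then have "y \<noteq> poly V x" using e by (auto simp: s_def)
            then show ?thesis using False o1 by (simp add: Q lookup_mdiv_Aff F_def)
          qed
        next
          case False
          then have "ord x y F = 0" using o1 ord_unit[OF on', of "[:U:]"] by (simp add: F_def)
          then show ?thesis using False o1 by (simp add: Q lookup_mdiv_Aff)
        qed
      qed
      moreover have "basic_open f K0 {Aff a b | a b. Aff a b \<in> curve f \<and> eval2 [:s, 1:] a b \<noteq> 0}"
        using s by (intro basic_openI) (auto simp: over_pCons over_0 polys0_closed)
      ultimately show ?thesis using Aff P es over_1 one_in_coord_funs coord_funs_over_iff F
        by (intro exI[of _ "{Aff a b | a b. Aff a b \<in> curve f \<and> eval2 [:s, 1:] a b \<noteq> 0}"]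
            conjI bexI[of _ F] bexI[of _ 1] ballI) auto
    qed
  qed
qed

theorem mumford_point_over_iff:
  "mumford_point f U V \<in> jacobian_over f K0 \<longleftrightarrow> U \<in> polys0 \<and> V \<in> polys0"
proof
  assume "U \<in> polys0 \<and> V \<in> polys0"
  then show "mumford_point f U V \<in> jacobian_over f K0"
    unfolding mumford_point_eq jacobian_over_def using mdiv_in_Div0 mdiv_defined_over by blast
qed (rule coeffs_over_of_class_over)

end

section \<open>The polynomials attached to a half\<close>

text \<open>
An algebraically closed field is infinite: a nonzero polynomial \<open>p\<close> vanishing everywhere would leave
\<open>x p + 1\<close> without a root.
\<close>

lemma poly_eqI_fun:
  fixes p q :: "'a::alg_closed_field poly"
  assumes "\<And>x. poly p x = poly q x" shows "p = q"
proof (rule ccontr)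
  assume "p \<noteq> q"
  then have "degree ([:0, 1:] * (p - q) + 1) = Suc (degree (p - q))"
    by (subst degree_add_eq_left) (auto simp: degree_mult_eq)
  then obtain c where "poly ([:0, 1:] * (p - q) + 1) c = 0"
    using alg_closed_imp_poly_has_root[of "[:0, 1:] * (p - q) + 1"] by auto
  then show False using assms by simp
qed

lemma elem_sym_0 [simp]: "elem_sym n r 0 = 1"
proof -
  have "{A. A \<subseteq> {1..n} \<and> card A = 0} = {{}}" using finite_subset by fastforce
  then show ?thesis by (simp add: elem_sym_def)
qed

lemma elem_sym_top: "elem_sym n r n = (\<Prod>i=1..n. r i)"
proof -
  have "A = {1..n}" if "A \<subseteq> {1..n}" "card A = n" for A
    using card_subset_eq[of "{1..n}" A] that by simp
  then have "{A. A \<subseteq> {1..n} \<and> card A = n} = {{1..n}}" by auto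
  then show ?thesis by (simp add: elem_sym_def)
qed

lemma prod_linear_elem_sym:
  "(\<Prod>i=1..n. [:- r i, 1:]) = (\<Sum>i\<le>n. monom ((-1) ^ i * elem_sym n r i) (n - i))"
proof -
  have "(\<Prod>i=1..n. [:- r i, 1:]) = (\<Prod>i\<in>{1..n}. [:- r i:] + [:0, 1:])" by simp
  also have "\<dots> = (\<Sum>X\<in>Pow {1..n}. (\<Prod>i\<in>X. [:- r i:]) * (\<Prod>i\<in>{1..n} - X. [:0, 1:]))"
    by (rule prod_add) simp
  also have "\<dots> = (\<Sum>X\<in>Pow {1..n}. monom ((-1) ^ card X * (\<Prod>i\<in>X. r i)) (n - card X))"
  proof (rule sum.cong)
    fix X assume "X \<in> Pow {1..n}"
    then have X: "finite X" "card ({1..n} - X) = n - card X"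
      using finite_subset by (auto simp: card_Diff_subset finite_subset)
    have "(\<Prod>i\<in>X. [:- r i:]) = [:(-1) ^ card X * (\<Prod>i\<in>X. r i):]"
      using X(1) by induction (simp_all add: ac_simps)
    then show "(\<Prod>i\<in>X. [:- r i:]) * (\<Prod>i\<in>{1..n} - X. [:0, 1:])
        = monom ((-1) ^ card X * (\<Prod>i\<in>X. r i)) (n - card X)"
      by (simp only: prod_constant X(2)) (simp add: monom_altdef)
  qed simp
  also have "\<dots> = (\<Sum>i\<le>n. \<Sum>X\<in>{X \<in> Pow {1..n}. card X = i}. monom ((-1) ^ card X * (\<Prod>i\<in>X. r i)) (n - card X))"
  proof (rule sum.group[symmetric])
    show "card ` Pow {1..n} \<subseteq> {..n}" using card_mono[of "{1..n}"] by fastforce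
  qed auto
  also have "\<dots> = (\<Sum>i\<le>n. monom ((-1) ^ i * elem_sym n r i) (n - i))"
  proof (rule sum.cong)
    fix i
    have "(\<Sum>X\<in>{X \<in> Pow {1..n}. card X = i}. monom ((-1) ^ card X * (\<Prod>i\<in>X. r i)) (n - card X))
      = (\<Sum>X\<in>{X \<in> Pow {1..n}. card X = i}. monom ((-1) ^ i * (\<Prod>i\<in>X. r i)) (n - i))"
      by (rule sum.cong) auto
    also have "\<dots> = monom ((-1) ^ i * elem_sym n r i) (n - i)"
      by (simp add: elem_sym_def sum_distrib_left monom_sum)
    finally show "(\<Sum>X\<in>{X \<in> Pow {1..n}. card X = i}. monom ((-1) ^ card X * (\<Prod>i\<in>X. r i)) (n - card X))
      = monom ((-1) ^ i * elem_sym n r i) (n - i)" .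
  qed simp
  finally show ?thesis .
qed

lemma coeff_h_poly:
  assumes "i \<le> 2 * g + 1"
  shows "coeff (h_poly g r) (2 * g + 1 - i) = (-1) ^ i * elem_sym (2 * g + 1) r i"
proof -
  have "coeff (h_poly g r) (2 * g + 1 - i) =
      (\<Sum>j\<le>2 * g + 1. if j = i then (-1) ^ i * elem_sym (2 * g + 1) r i else 0)"
    unfolding h_poly_def prod_linear_elem_sym coeff_sum
    using assms by (intro sum.cong) auto
  then show ?thesis using assms by simp
qed

lemma degree_h_poly: "degree (h_poly g r) \<le> 2 * g + 1"
  unfolding h_poly_def prod_linear_elem_sym
  by (intro degree_sum_le order_trans[OF degree_monom_le]) auto

text \<open>
The polynomials \<open>A\<close> and \<open>B\<close> with \<open>h(t) = t A(t\<^sup>2) - B(t\<^sup>2)\<close>. On substituting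
\<open>a - x\<close> they become \<open>(-1)^g U\<close> and \<open>V'\<close>.
\<close>

definition even_part :: "nat \<Rightarrow> (nat \<Rightarrow> 'a::field) \<Rightarrow> 'a poly" where
  "even_part g r = (\<Sum>j\<le>g. monom (elem_sym (2 * g + 1) r (2 * j)) (g - j))"

definition odd_part :: "nat \<Rightarrow> (nat \<Rightarrow> 'a::field) \<Rightarrow> 'a poly" where
  "odd_part g r = (\<Sum>j\<le>g. monom (elem_sym (2 * g + 1) r (2 * j + 1)) (g - j))"

lemma sum_even_odd: "(\<Sum>i\<le>2 * g + 1. F i) = (\<Sum>j\<le>g. F (2 * j) + F (2 * j + 1 :: nat) :: 'b::comm_monoid_add)"
  by (induction g) (simp_all add: ac_simps)

lemma poly_h_poly: "poly (h_poly g r) t = t * poly (even_part g r) (t\<^sup>2) - poly (odd_part g r) (t\<^sup>2)"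
proof -
  have "poly (h_poly g r) t = (\<Sum>i\<le>2 * g + 1. (-1) ^ i * elem_sym (2 * g + 1) r i * t ^ (2 * g + 1 - i))"
    by (simp only: h_poly_def prod_linear_elem_sym poly_sum poly_monom)
  also have "\<dots> = (\<Sum>j\<le>g. elem_sym (2 * g + 1) r (2 * j) * t ^ (2 * g + 1 - 2 * j)
      - elem_sym (2 * g + 1) r (2 * j + 1) * t ^ (2 * g - 2 * j))"
    unfolding sum_even_odd by (intro sum.cong) auto
  also have "\<dots> = (\<Sum>j\<le>g. t * (elem_sym (2 * g + 1) r (2 * j) * (t\<^sup>2) ^ (g - j))
      - elem_sym (2 * g + 1) r (2 * j + 1) * (t\<^sup>2) ^ (g - j))"
  proof (intro sum.cong refl)
    fix j assume "j \<in> {..g}"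
    then have "2 * g + 1 - 2 * j = Suc (2 * (g - j))" "2 * g - 2 * j = 2 * (g - j)" by auto
    then show "elem_sym (2 * g + 1) r (2 * j) * t ^ (2 * g + 1 - 2 * j)
        - elem_sym (2 * g + 1) r (2 * j + 1) * t ^ (2 * g - 2 * j)
      = t * (elem_sym (2 * g + 1) r (2 * j) * (t\<^sup>2) ^ (g - j))
        - elem_sym (2 * g + 1) r (2 * j + 1) * (t\<^sup>2) ^ (g - j)"
      by (simp only: power_Suc power_mult) (simp add: ac_simps)
  qed
  also have "\<dots> = t * poly (even_part g r) (t\<^sup>2) - poly (odd_part g r) (t\<^sup>2)"
    by (simp add: even_part_def odd_part_def poly_sum poly_monom sum_subtractf sum_distrib_left)
  finally show ?thesis .
qed

lemma coeff_even_part: "j \<le> g \<Longrightarrow> coeff (even_part g r) (g - j) = elem_sym (2 * g + 1) r (2 * j)"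
proof -
  assume j: "j \<le> g"
  have "coeff (even_part g r) (g - j) = (\<Sum>i\<le>g. if i = j then elem_sym (2 * g + 1) r (2 * j) else 0)"
    unfolding even_part_def coeff_sum using j by (intro sum.cong) auto
  then show ?thesis using j by simp
qed

lemma coeff_odd_part: "j \<le> g \<Longrightarrow> coeff (odd_part g r) (g - j) = elem_sym (2 * g + 1) r (2 * j + 1)"
proof -
  assume j: "j \<le> g"
  have "coeff (odd_part g r) (g - j) = (\<Sum>i\<le>g. if i = j then elem_sym (2 * g + 1) r (2 * j + 1) else 0)"
    unfolding odd_part_def coeff_sum using j by (intro sum.cong) auto
  then show ?thesis using j by simp
qed

lemma sum_split_0: "(\<Sum>j\<le>g. F j) = F 0 + (\<Sum>j=1..g. F (j::nat) :: 'b::comm_monoid_add)"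
  by (simp add: atMost_atLeast0 sum.atLeast_Suc_atMost)

lemma poly_U_poly: "poly (U_poly g a r) x = (-1) ^ g * poly (even_part g r) (a - x)"
proof -
  have "poly (even_part g r) (a - x)
      = (a - x) ^ g + (\<Sum>j=1..g. elem_sym (2 * g + 1) r (2 * j) * (a - x) ^ (g - j))"
    by (simp add: even_part_def poly_sum poly_monom sum_split_0)
  then show ?thesis by (simp add: U_poly_def poly_sum)
qed

lemma poly_V_poly:
  assumes "elem_sym (2 * g + 1) r (2 * g + 1) = - b"
  shows "poly (V_poly g a b r) x
    = poly (odd_part g r) (a - x) - elem_sym (2 * g + 1) r 1 * poly (even_part g r) (a - x)"
proof -
  have e: "poly (even_part g r) (a - x)
      = (a - x) ^ g + (\<Sum>j=1..g. elem_sym (2 * g + 1) r (2 * j) * (a - x) ^ (g - j))"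
    by (simp add: even_part_def poly_sum poly_monom sum_split_0)
  have "poly (odd_part g r) (a - x) = (\<Sum>j\<le>g. elem_sym (2 * g + 1) r (2 * j + 1) * (a - x) ^ (g - j))"
    by (simp add: odd_part_def poly_sum poly_monom)
  also have "\<dots> = (\<Sum>j<g. elem_sym (2 * g + 1) r (2 * j + 1) * (a - x) ^ (g - j)) - b"
    using assms by (simp add: lessThan_Suc_atMost[symmetric])
  also have "(\<Sum>j<g. elem_sym (2 * g + 1) r (2 * j + 1) * (a - x) ^ (g - j))
      = (\<Sum>j=1..g. elem_sym (2 * g + 1) r (2 * j - 1) * (a - x) ^ (g - j + 1))"
    by (rule sum.reindex_bij_witness[of _ "\<lambda>j. j - 1" Suc])
      (auto simp: Suc_diff_Suc simp flip: power_Suc)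
  finally show ?thesis unfolding e by (simp add: V_poly_def poly_sum left_diff_distrib)
qed

locale half =
  fixes g :: nat and \<alpha> r :: "nat \<Rightarrow> 'a::alg_closed_field" and a b :: 'a
  assumes char: "CHAR('a) \<noteq> 2"
    and g_pos: "g \<ge> 1"
    and inj: "inj_on \<alpha> {1..2*g+1}"
    and half: "r \<in> half_tuples g \<alpha> a b"
begin

abbreviation "f \<equiv> hyp_poly g \<alpha>"
abbreviation "s \<equiv> elem_sym (2 * g + 1) r"
abbreviation "U \<equiv> U_poly g a r"
abbreviation "V \<equiv> V_poly g a b r"

definition \<kappa> :: 'a where "\<kappa> = s 1 * (-1) ^ g"
definition V' :: "'a poly" where "V' = V + smult \<kappa> U"
definition W :: "'a poly" where "W = smult (2 * \<kappa>) V + smult (\<kappa>\<^sup>2) U + [:- a, 1:] * U"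

lemma r_squared: "i \<in> {1..2*g+1} \<Longrightarrow> (r i)\<^sup>2 = a - \<alpha> i"
  using half by (simp add: half_tuples_def)

lemma s_top: "s (2 * g + 1) = - b"
  using half by (simp only: elem_sym_top half_tuples_def mem_Collect_eq)

text \<open>
Both sides are \<open>h(t) h(-t)\<close>.
\<close>

lemma f_squares: "poly f (a - t\<^sup>2) = (poly (odd_part g r) (t\<^sup>2))\<^sup>2 - t\<^sup>2 * (poly (even_part g r) (t\<^sup>2))\<^sup>2"
proof -
  have "poly f (a - t\<^sup>2) = (\<Prod>i=1..2*g+1. (r i)\<^sup>2 - t\<^sup>2)"
    unfolding hyp_poly_def poly_prod using r_squared by (intro prod.cong) auto
  also have "\<dots> = (\<Prod>i=1..2*g+1. (t - r i) * (- t - r i))"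
    by (intro prod.cong) (auto simp: power2_eq_square algebra_simps)
  also have "\<dots> = poly (h_poly g r) t * poly (h_poly g r) (- t)"
    unfolding h_poly_def poly_prod prod.distrib
    by (intro arg_cong2[where f = "(*)"] prod.cong) auto
  also have "\<dots> = (poly (odd_part g r) (t\<^sup>2))\<^sup>2 - t\<^sup>2 * (poly (even_part g r) (t\<^sup>2))\<^sup>2"
    unfolding poly_h_poly by (simp add: power2_eq_square algebra_simps)
  finally show ?thesis .
qed

lemma poly_V': "poly V' x = poly (odd_part g r) (a - x)"
proof -
  have "(-1) ^ g * ((-1) ^ g * c) = c" for c :: 'a
    by (simp flip: mult.assoc power_mult_distrib)
  then show ?thesis
    unfolding V'_def \<kappa>_def by (simp add: poly_V_poly[OF s_top] poly_U_poly mult.assoc)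
qed

lemma f_decomposition: "f = V'\<^sup>2 + [:- a, 1:] * U\<^sup>2"
proof (rule poly_eqI_fun)
  fix x
  obtain t where t: "t\<^sup>2 = a - x" using nth_root_exists[of 2 "a - x"] by auto
  have sq: "((-1) ^ g)\<^sup>2 = (1 :: 'a)"
    by (metis power_minus1_even power_mult mult.commute)
  have "poly f x = (poly (odd_part g r) (a - x))\<^sup>2 - (a - x) * (poly (even_part g r) (a - x))\<^sup>2"
    using f_squares[of t] unfolding t by simp
  then show "poly f x = poly (V'\<^sup>2 + [:- a, 1:] * U\<^sup>2) x"
    by (simp add: poly_V' poly_U_poly power_mult_distrib sq algebra_simps)
qed

lemma f_eq: "f - V\<^sup>2 = U * W"
proof -
  have "V'\<^sup>2 = V\<^sup>2 + U * (smult (2 * \<kappa>) V + smult (\<kappa>\<^sup>2) U)"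
    by (rule poly_eqI_fun) (simp add: V'_def power2_eq_square algebra_simps)
  then show ?thesis unfolding f_decomposition W_def by (simp add: power2_eq_square algebra_simps)
qed

lemma degree_shift: "degree ([:a, -1:] ^ k) = k" "coeff ([:a, -1:] ^ k) k = (-1) ^ k"
proof -
  show d: "degree ([:a, -1:] ^ k) = k" by (simp add: degree_power_eq)
  show "coeff ([:a, -1:] ^ k) k = (-1) ^ k" using lead_coeff_power[of "[:a, -1:]" k] d by simp
qed

lemma U_degree: "degree U = g" "lead_coeff U = 1"
proof -
  define S where "S = (\<Sum>j=1..g. smult (s (2 * j)) ([:a, -1:] ^ (g - j)))"
  have U: "U = smult ((-1) ^ g) ([:a, -1:] ^ g + S)"
    unfolding U_poly_def S_def by (simp add: minus_one_power_iff)
  have "degree S < g" unfolding S_def using g_pos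
    by (intro degree_sum_less le_less_trans[OF degree_smult_le]) (auto simp: degree_shift)
  then have "degree ([:a, -1:] ^ g + S) = g" "coeff ([:a, -1:] ^ g + S) g = (-1) ^ g"
    using degree_shift[of g] by (auto simp: degree_add_eq_left coeff_eq_0)
  then show d: "degree U = g" and "lead_coeff U = 1"
    unfolding U by (simp_all flip: power_mult_distrib)
qed

lemma V_degree: "degree V < g"
proof -
  define S1 where "S1 = (\<Sum>j=2..g. smult (s (2 * j - 1)) ([:a, -1:] ^ (g - j + 1)))"
  define S2 where "S2 = (\<Sum>j=1..g. smult (s (2 * j)) ([:a, -1:] ^ (g - j)))"
  \<comment> \<open>The subtraction of \<open>s 1\<close> times the bracket in \<open>V\<close> cancels exactly this summand, the only one of degree \<open>g\<close>.\<close>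
  have "(\<Sum>j=1..g. smult (s (2 * j - 1)) ([:a, -1:] ^ (g - j + 1))) = smult (s 1) ([:a, -1:] ^ g) + S1"
    unfolding S1_def using g_pos
    by (subst sum.atLeast_Suc_atMost) (auto simp: numeral_2_eq_2)
  then have "V = S1 - [:b:] - smult (s 1) S2"
    unfolding V_poly_def S2_def by (simp add: smult_add_right)
  moreover have "degree S1 < g" unfolding S1_def using g_pos
    by (intro degree_sum_less le_less_trans[OF degree_smult_le])
       (auto simp: degree_shift simp del: power_Suc)
  moreover have "degree (smult (s 1) S2) < g" unfolding S2_def using g_pos
    by (intro le_less_trans[OF degree_smult_le] degree_sum_less) (auto simp: degree_shift)
  ultimately show ?thesis using g_pos by (auto intro!: degree_diff_less)
qed

lemma proots_f: "f \<noteq> 0" "proots f = (\<Sum>i\<in>{1..2*g+1}. {#\<alpha> i#})"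
  unfolding hyp_poly_def by (auto simp: proots_prod simp del: prod.cl_ivl_Suc sum.cl_ivl_Suc)

lemma f_degree: "degree f = 2 * g + 1"
  unfolding hyp_poly_def by (subst degree_prod_eq_sum_degree) auto

lemma f_rsquarefree: "rsquarefree f"
  unfolding rsquarefree_def
proof (intro conjI allI proots_f)
  fix c
  have "order c f = (\<Sum>i\<in>{1..2*g+1}. if \<alpha> i = c then 1 else 0)"
    using proots_f by (subst count_proots[symmetric]) (auto simp: count_sum intro!: sum.cong)
  also have "\<dots> = card {i \<in> {1..2*g+1}. \<alpha> i = c}" by (simp add: sum.If_cases Int_def del: sum.cl_ivl_Suc)
  also have "\<dots> \<le> Suc 0" using inj by (subst card_le_Suc0_iff_eq) (auto simp: inj_on_def)
  finally show "order c f = 0 \<or> order c f = 1" by linarith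
qed

lemma two_neq_0: "(2::'a) \<noteq> 0"
proof
  assume "(2::'a) = 0"
  then have "of_nat 2 = (0::'a)" by simp
  then have "CHAR('a) dvd 2" by (simp only: of_nat_eq_0_iff_char_dvd)
  then show False using char CHAR_not_1 by (metis dvd_imp_le le_less less_2_cases nat_dvd_not_less CHAR_not_1' dvd_0_left pos2)
qed

text \<open>
A common root of \<open>U\<close> and \<open>V\<close> is a double root of \<open>V'\<^sup>2 + (x - a) U\<^sup>2 = f\<close>.
\<close>

lemma common_root: assumes "poly U c = 0" shows "poly V c \<noteq> 0"
proof
  assume "poly V c = 0"
  then have "poly V' c = 0" using assms by (simp add: V'_def)
  then have "[:- c, 1:] dvd V'" "[:- c, 1:] dvd U" using assms by (simp_all add: poly_eq_0_iff_dvd)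
  then have "[:- c, 1:] ^ 2 dvd V'\<^sup>2 + [:- a, 1:] * U\<^sup>2"
    by (intro dvd_add dvd_mult dvd_power_same)
  then have "2 \<le> order c f" using proots_f(1) order_divides[of c 2 f] f_decomposition by auto
  then show False using f_rsquarefree by (auto simp: rsquarefree_def dest: spec[of _ c])
qed

sublocale mumford_pair f U V W
proof
  show "odd (degree f)" by (simp add: f_degree)
  show "2 * degree U < degree f" by (simp add: f_degree U_degree)
  show "V = 0 \<or> degree V < degree U" using V_degree by (simp add: U_degree)
qed (fact f_rsquarefree two_neq_0 U_degree f_eq common_root)+

end

section \<open>Rationality of halves\<close>

locale half_over = half g \<alpha> r a b + subfield_projection K0 L
  for g :: nat and \<alpha> r :: "nat \<Rightarrow> 'a::alg_closed_field" and a b and K0 :: "'a set" and L +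
  assumes f_over: "hyp_poly g \<alpha> \<in> polys_over K0" and a_over: "a \<in> K0" and b_over: "b \<in> K0"
begin

sublocale rational_mumford_pair f U V W K0 L
  by unfold_locales (rule f_over)

lemma h_over_iff: "h_poly g r \<in> polys0 \<longleftrightarrow> (\<forall>i\<in>{1..2*g}. s i \<in> K0)"
proof
  assume h: "h_poly g r \<in> polys0"
  show "\<forall>i\<in>{1..2*g}. s i \<in> K0"
  proof
    fix i assume "i \<in> {1..2*g}"
    then have "coeff (h_poly g r) (2 * g + 1 - i) = (-1) ^ i * s i" by (intro coeff_h_poly) simp
    then have "(-1) ^ i * s i \<in> K0" using h by (metis (mono_tags, lifting) polys_over_def mem_Collect_eq)
    from sub_closed(4)[OF _ this] have "(-1) ^ i * ((-1) ^ i * s i) \<in> K0" by (simp only: sub_closed)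
    moreover have "(-1) ^ i * ((-1) ^ i * s i) = s i" by (simp flip: mult.assoc power_mult_distrib)
    ultimately show "s i \<in> K0" by (simp only:)
  qed
next
  assume *: "\<forall>i\<in>{1..2*g}. s i \<in> K0"
  have s: "s i \<in> K0" if "i \<le> 2 * g + 1" for i
  proof -
    have "i = 0 \<or> i \<in> {1..2*g} \<or> i = 2 * g + 1" using that by auto
    then consider "i = 0" | "i \<in> {1..2*g}" | "i = 2 * g + 1" by blast
    then show ?thesis using * s_top b_over by cases (auto simp: sub_closed)
  qed
  show "h_poly g r \<in> polys0"
    unfolding polys_over_def mem_Collect_eq
  proof
    fix k
    show "coeff (h_poly g r) k \<in> K0"
    proof (cases "k \<le> 2 * g + 1")
      case True
      then have "coeff (h_poly g r) (2 * g + 1 - (2 * g + 1 - k)) = (-1) ^ (2 * g + 1 - k) * s (2 * g + 1 - k)"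
        by (intro coeff_h_poly) simp
      then have "coeff (h_poly g r) k = (-1) ^ (2 * g + 1 - k) * s (2 * g + 1 - k)" using True by simp
      then show ?thesis using s[of "2 * g + 1 - k"] by (auto intro: sub_closed)
    next
      case False
      then have "coeff (h_poly g r) k = 0" using degree_h_poly[of g r] by (intro coeff_eq_0) simp
      then show ?thesis by (simp add: sub_closed)
    qed
  qed
qed

lemma UV_over_of_s_over:
  assumes "\<forall>i\<in>{1..2*g}. s i \<in> K0"
  shows "U \<in> polys0 \<and> V \<in> polys0"
proof -
  have z: "[:a, -1:] ^ k \<in> polys0" for k by (intro polys0_closed sub_closed a_over)
  have "smult (s (2 * j)) ([:a, -1:] ^ (g - j)) \<in> polys0"
    "smult (s (2 * j - 1)) ([:a, -1:] ^ (g - j + 1)) \<in> polys0" if "j \<in> {1..g}" for j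
  proof -
    have "2 * j \<in> {1..2*g}" "2 * j - 1 \<in> {1..2*g}" using that by auto
    then have "s (2 * j) \<in> K0" "s (2 * j - 1) \<in> K0" using assms by blast+
    then show "smult (s (2 * j)) ([:a, -1:] ^ (g - j)) \<in> polys0"
      "smult (s (2 * j - 1)) ([:a, -1:] ^ (g - j + 1)) \<in> polys0"
      using polys0_closed(9) z by blast+
  qed
  then have sums: "(\<Sum>j=1..g. smult (s (2 * j)) ([:a, -1:] ^ (g - j))) \<in> polys0"
    "(\<Sum>j=1..g. smult (s (2 * j - 1)) ([:a, -1:] ^ (g - j + 1))) \<in> polys0"
    by (auto intro!: polys0_sum)
  have "s 1 \<in> K0" using assms g_pos by auto
  then show ?thesis unfolding U_poly_def V_poly_def
    by (intro conjI polys0_closed sums z sub_closed b_over)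
qed

text \<open>
The quotient \<open>W = (f - V\<^sup>2) / U\<close> is over \<open>K0\<close>, hence so is \<open>2 \<kappa> V + \<kappa>\<^sup>2 U\<close>. As \<open>U\<close> is monic of degree \<open>g\<close> and
\<open>V\<close> has smaller degree, the coefficient of \<open>x^g\<close> is \<open>\<kappa>\<^sup>2\<close>. What remains is \<open>2 \<kappa> V\<close> with \<open>V \<noteq> 0\<close>, which
gives \<open>\<kappa>\<close> as the characteristic is not 2.
\<close>

lemma \<kappa>_over:
  assumes "U \<in> polys0" "V \<in> polys0" shows "\<kappa> \<in> K0"
proof -
  have "U * W \<in> polys0" unfolding f_eq[symmetric] by (intro polys0_closed f_over assms)
  then have "W \<in> polys0" using projp_quotient assms(1) U_neq_0 by blast
  then have "W - [:- a, 1:] * U \<in> polys0" by (intro polys0_closed sub_closed a_over assms)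
  then have WU: "smult (2 * \<kappa>) V + smult (\<kappa>\<^sup>2) U \<in> polys0" by (simp add: W_def)
  have "coeff V g = 0" using V_degree by (simp add: coeff_eq_0)
  moreover have "coeff U g = 1" using U_degree by simp
  ultimately have "coeff (smult (2 * \<kappa>) V + smult (\<kappa>\<^sup>2) U) g = \<kappa>\<^sup>2" by simp
  then have "\<kappa>\<^sup>2 \<in> K0" using WU by (metis (mono_tags, lifting) polys_over_def mem_Collect_eq)
  then have "(smult (2 * \<kappa>) V + smult (\<kappa>\<^sup>2) U) - smult (\<kappa>\<^sup>2) U \<in> polys0"
    by (intro polys0_closed(4,9) WU assms)
  then have kV: "smult (2 * \<kappa>) V \<in> polys0" by simp
  have "V \<noteq> 0"
  proof -
    obtain c where "poly U c = 0" using alg_closed_imp_poly_has_root[of U] U_degree g_pos by auto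
    then show ?thesis using common_root by auto
  qed
  then obtain i where i: "coeff V i \<noteq> 0" by (metis poly_eq_iff coeff_0)
  have k: "2 * \<kappa> * coeff V i \<in> K0" and v: "coeff V i \<in> K0" using kV assms(2) by (auto simp: polys_over_def)
  have two: "(2 :: 'a) \<in> K0" using sub_closed(3)[OF sub_closed(2) sub_closed(2)] by simp
  have "inverse 2 * (inverse (coeff V i) * (2 * \<kappa> * coeff V i)) \<in> K0"
    by (rule sub_closed(4)[OF sub_closed(6)[OF two] sub_closed(4)[OF sub_closed(6)[OF v] k]])
  also have "inverse 2 * (inverse (coeff V i) * (2 * \<kappa> * coeff V i)) = \<kappa>"
    using i two_neq_0 by (simp add: field_simps)
  finally show ?thesis .
qed

lemma pcompose_over: "p \<in> polys0 \<Longrightarrow> pcompose p [:a, -1:] \<in> polys0"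
  unfolding polys_over_def mem_Collect_eq
  by (intro allI coeff_pcompose_semiring_closed sub_closed)
     (auto simp: coeff_pCons sub_closed a_over split: nat.splits)

lemma s_over_of_UV_over:
  assumes "U \<in> polys0" "V \<in> polys0"
  shows "\<forall>i\<in>{1..2*g}. s i \<in> K0"
proof -
  have \<kappa>: "\<kappa> \<in> K0" using \<kappa>_over assms .
  have sgn: "(-1) ^ g * ((-1) ^ g * c) = c" for c :: 'a by (simp flip: mult.assoc power_mult_distrib)
  have "even_part g r = smult ((-1) ^ g) (pcompose U [:a, -1:])"
    by (rule poly_eqI_fun) (simp add: poly_pcompose poly_U_poly sgn)
  then have ev: "even_part g r \<in> polys0"
    using assms by (auto intro!: polys0_closed(9) pcompose_over sub_closed)
  have "odd_part g r = pcompose V' [:a, -1:]"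
    by (rule poly_eqI_fun) (simp add: poly_pcompose poly_V')
  moreover have "V' \<in> polys0" unfolding V'_def by (intro polys0_closed(3,9) assms \<kappa>)
  ultimately have od: "odd_part g r \<in> polys0" using pcompose_over by simp
  show ?thesis
  proof
    fix i assume i: "i \<in> {1..2*g}"
    define j where "j = i div 2"
    have "j \<le> g" using i by (auto simp: j_def)
    then have "s (2 * j) \<in> K0" "s (2 * j + 1) \<in> K0"
      using ev od coeff_even_part[of j g r] coeff_odd_part[of j g r]
      by (metis (mono_tags, lifting) polys_over_def mem_Collect_eq)+
    moreover have "i = 2 * j \<or> i = 2 * j + 1" unfolding j_def by presburger
    ultimately show "s i \<in> K0" by metis
  qed
qed

lemma half_point_over_iff: "half_point g \<alpha> a b r \<in> jacobian_over f K0 \<longleftrightarrow> h_poly g r \<in> polys0"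
  unfolding half_point_def mumford_point_over_iff h_over_iff
  using UV_over_of_s_over s_over_of_UV_over by blast

end

theorem theorem4p4:
  fixes K0 :: "'a::alg_closed_field set"
    and g :: nat and \<alpha> r :: "nat \<Rightarrow> 'a" and a b :: 'a
  assumes "CHAR('a) \<noteq> 2"
    and "g \<ge> 1"
    and "inj_on \<alpha> {1..2*g+1}"
    and "is_subfield K0"
    and "hyp_poly g \<alpha> \<in> polys_over K0"
    and "a \<in> K0" and "b \<in> K0" and "b ^ 2 = poly (hyp_poly g \<alpha>) a"
    and "r \<in> half_tuples g \<alpha> a b"
  shows "(half_point g \<alpha> a b r \<in> jacobian_over (hyp_poly g \<alpha>) K0
            \<longleftrightarrow> h_poly g r \<in> polys_over K0) \<and>
         (h_poly g r \<in> polys_over K0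
            \<longleftrightarrow> (\<forall>i\<in>{1..2*g}. elem_sym (2*g+1) r i \<in> K0))"
proof -
  obtain L where "subfield_projection K0 L" using subfield_projection_exists assms(4) by blast
  then interpret half_over g \<alpha> r a b K0 L
    using assms by (intro half_over.intro half.intro half_over_axioms.intro)
  show ?thesis using half_point_over_iff h_over_iff by blast
qed

end
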